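(* Let $2\leq a<b<c$ be integers with $2\mid abc$ and $\gcd(a,b,c)=1$. Suppose that the system of equations \[ 1+x^a+y^a=1+x^b+y^b=1+x^c+y^c=0 \] has a solution $(x,y)\in\mathbb{C}^2$ where $x$ and $y$ are not cube roots of unity. Then: (1) We have $b<600\,a^2\,2^a$. (2) If exactly one of $a,b,c$ is even, then $b<600\,a^2$. (3) For each fixed $a$ and each $b$ in the range $a<b<600\,a^2\,2^a$, there are at most finitely many possible choices for $c$; that is, for fixed integers $a,b$ with $2\leq a<b<600\,a^2\,2^a$, there are only finitely many integers $c>b$ with $2\mid abc$ and $\gcd(a,b,c)=1$ for which the system above has a solution $(x,y)\in\mathbb{C}^2$ where $x$ and $y$ are not cube roots of unity.
   Context: A cube root of unity is any complex number $z$ with $z^3=1$ (including $z=1$). *)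

theory Defs
  imports Complex_Main
begin

definition is_cube_root_of_unity :: "complex \<Rightarrow> bool" where
  "is_cube_root_of_unity z \<longleftrightarrow> z ^ 3 = 1"

definition has_nontrivial_solution :: "nat \<Rightarrow> nat \<Rightarrow> nat \<Rightarrow> bool" where
  "has_nontrivial_solution a b c \<longleftrightarrow>
     (\<exists>x y :: complex. \<not> is_cube_root_of_unity x \<and> \<not> is_cube_root_of_unity y \<and>
        1 + x ^ a + y ^ a = 0 \<and> 1 + x ^ b + y ^ b = 0 \<and> 1 + x ^ c + y ^ c = 0)"

end

theory Submission
  imports Defs "HOL-Computational_Algebra.Computational_Algebra" "HOL-Computational_Algebra.Field_as_Ring"
begin

text \<open>
  Write a solution projectively as z = (1, x, y), so that z1^n + z2^n + z3^n = 0 for each exponent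
  n of the system, and put R = max (1, |x|, |y|). The proof plays two facts about heights against
  each other, applied to the solution and to all its algebraic conjugates at once. It gives b <
  600 a (lemma exponent_bound), from which all three claims follow.

  First, the height of z is at least of order 1/a. The numbers U = 1, V = x^a, W = y^a have sum 0,
  and whenever U + V + W = 0 the form F = (UV + VW + WU) (UVW)^2 satisfies |F| \<le> m^8 / 4 where
  m is the largest of |U|, |V|, |W| (lemma e2_e3_bound). The constant 1/4 is what a trivial
  estimate lacks.

  Second, the height of z is at most of order 1/b. The vectors (z_i^b) and (z_i^c) are orthogonal
  to (1, 1, 1). With X, Y, Z for the b-th powers, Pade approximation to binomial functions gives
  forms P_i with integer coefficients such that X^M P_1 + Y^M P_2 + Z^M P_3 = 0 identically on X +
  Y + Z = 0, with degree about M/2 and coefficients exponential in M (lemma pade_identity). The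
  cross product of (X^M P_1, Y^M P_2, Z^M P_3) with (z_i^c) is a multiple of (1, 1, 1), say D (1,
  1, 1); its coordinates show that D is divisible by the k-th power of each of z2 z3, z1 z3 and z1
  z2, where k is the smaller of M b and c. So theta = D / (z1 z2 z3)^k has the property that theta
  z_i^k is, for each i, an integral form in z of the same degree k - e. If M is chosen near c/b,
  then e > 0: theta behaves like a form of negative degree -e, and |theta| R^e \<le> C at every
  conjugate. Multiplication by theta also maps integral forms of large degree d to integral forms
  of degree d - e.

  Hence eta = theta^(8a) F^e has degree 0. All its powers lie in one finitely generated subgroup
  of Q(x), and all its conjugates are at most C^(8a) / 4^e in absolute value, which is less than 1
  when b \<ge> 600 a. Expressing the powers of eta in the basis 1, x, x^2, ... of Q(x), their
  coordinates have a common denominator and tend to 0, so eta = 0 (lemma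
  small_conjugates_imp_zero). But eta is nonzero: as x and y are nonzero (lemma
  nonzero_coordinate), F vanishes only when |x| = |y| = 1, which forces x to be a cube root of
  unity (lemma not_both_unit), and two Pade systems with nonzero cross product (lemma
  pade_nondegenerate) cannot both make theta vanish. For c close to b, the vector (z_i^b) itself
  takes the place of the Pade system.

  For the finiteness claim, 1 + x^a + y^a = 1 + x^b + y^b = 0 has finitely many solutions. If
  infinitely many c occurred, one solution (x, y) would serve infinitely many of them, and the
  argument above, applied to two of these exponents c in place of b and c, bounds the smaller one
  by 600 a.
\<close>

section \<open>Pade forms on the line X + Y + Z = 0\<close>

text \<open>
  The integral of the polynomial f along the segment from \<alpha> to \<beta>. Path independence
  makes this the difference of two values of any antiderivative, so no analysis is involved.
\<close>

definition segment_integral :: "complex \<Rightarrow> complex \<Rightarrow> complex poly \<Rightarrow> complex" where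
  "segment_integral \<alpha> \<beta> f = (let F = (SOME F. pderiv F = f) in poly F \<beta> - poly F \<alpha>)"

lemma segment_integral_pderiv: "segment_integral \<alpha> \<beta> (pderiv F) = poly F \<beta> - poly F \<alpha>"
proof -
  define G where "G = (SOME G. pderiv G = pderiv F)"
  have "pderiv G = pderiv F" unfolding G_def by (rule someI[of _ F]) simp
  then have "pderiv (G - F) = 0" by (simp add: pderiv_diff)
  then obtain h where "G - F = [:h:]" using pderiv_iszero by blast
  then have "G = F + [:h:]" by (simp add: algebra_simps)
  then show ?thesis unfolding segment_integral_def Let_def G_def[symmetric] by simp
qed

lemma surj_pderiv: "\<exists>F. pderiv F = (f :: complex poly)"
proof -
  have "\<exists>F. pderiv F = monom c n" for c :: complex and n
    by (rule exI[of _ "monom (c / of_nat (Suc n)) (Suc n)"])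
       (simp add: pderiv_monom del: of_nat_Suc)
  then obtain A where A: "pderiv (A c n) = monom c n" for c :: complex and n by metis
  have "pderiv (\<Sum>i\<in>I. A (coeff f i) i) = (\<Sum>i\<in>I. monom (coeff f i) i)" for I
    by (induction I rule: infinite_finite_induct) (simp_all add: A pderiv_add)
  then have "pderiv (\<Sum>i\<le>degree f. A (coeff f i) i) = f"
    by (simp add: poly_as_sum_of_monoms)
  then show ?thesis by blast
qed

lemma segment_integral_add: "segment_integral \<alpha> \<beta> (f + g) = segment_integral \<alpha> \<beta> f + segment_integral \<alpha> \<beta> g"
proof -
  obtain F G where "pderiv F = f" "pderiv G = g" using surj_pderiv by metis
  then show ?thesis
    using segment_integral_pderiv[of \<alpha> \<beta> F] segment_integral_pderiv[of \<alpha> \<beta> G] segment_integral_pderiv[of \<alpha> \<beta> "F + G"]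
    by (simp add: pderiv_add)
qed

lemma segment_integral_smult: "segment_integral \<alpha> \<beta> (smult c f) = c * segment_integral \<alpha> \<beta> f"
proof -
  obtain F where "pderiv F = f" using surj_pderiv by metis
  then show ?thesis
    using segment_integral_pderiv[of \<alpha> \<beta> F] segment_integral_pderiv[of \<alpha> \<beta> "smult c F"]
    by (simp add: pderiv_smult right_diff_distrib)
qed

lemma segment_integral_sum: "segment_integral \<alpha> \<beta> (\<Sum>i\<in>A. f i) = (\<Sum>i\<in>A. segment_integral \<alpha> \<beta> (f i))"
proof (induction A rule: infinite_finite_induct)
  case (insert x F)
  then show ?case by (simp add: segment_integral_add)
qed (use segment_integral_smult[of \<alpha> \<beta> 0 0] in simp_all)

lemma segment_integral_cycle: "segment_integral \<alpha> \<beta> f + segment_integral \<beta> \<gamma> f + segment_integral \<gamma> \<alpha> f = 0"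
  by (simp add: segment_integral_def Let_def)

text \<open>
  Euler's beta integral on the segment from \<alpha> to \<beta>. Integration by parts moves one
  factor at a time from the first power to the second; the boundary terms vanish because a product
  of positive powers of both factors is zero at each end.
\<close>

lemma segment_integral_beta:
  "segment_integral \<alpha> \<beta> ([:-\<alpha>, 1:] ^ p * [:-\<beta>, 1:] ^ q)
     = (-1) ^ q * (\<beta> - \<alpha>) ^ (p + q + 1) * (fact p * fact q / fact (p + q + 1))"
proof (induction p arbitrary: q)
  case 0
  have "pderiv (smult (1 / of_nat (Suc q)) ([:-\<beta>, 1:] ^ Suc q)) = [:-\<beta>, 1:] ^ q"
    by (simp only: pderiv_smult pderiv_power_Suc smult_smult) (simp add: pderiv_pCons del: of_nat_Suc)
  from segment_integral_pderiv[of \<alpha> \<beta> "smult (1 / of_nat (Suc q)) ([:-\<beta>, 1:] ^ Suc q)", unfolded this]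
  have "segment_integral \<alpha> \<beta> ([:-\<beta>, 1:] ^ q) = - ((\<alpha> - \<beta>) ^ Suc q / of_nat (Suc q))"
    by (simp add: poly_power del: of_nat_Suc power_Suc)
  also have "(\<alpha> - \<beta>) ^ Suc q = (-1) ^ Suc q * (\<beta> - \<alpha>) ^ Suc q"
    by (subst power_mult_distrib[symmetric]) simp
  finally show ?case by (simp add: field_simps del: of_nat_Suc)
next
  case (Suc p)
  let ?u = "[:-\<alpha>, 1:]" and ?v = "[:-\<beta>, 1:]"
  have "pderiv (?u ^ Suc p * ?v ^ Suc q)
        = smult (of_nat (Suc p)) (?u ^ p * ?v ^ Suc q) + smult (of_nat (Suc q)) (?u ^ Suc p * ?v ^ q)"
  proof -
    have "pderiv ?u = 1" "pderiv ?v = 1" by (simp_all add: pderiv_pCons one_pCons)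
    then have "pderiv (?u ^ Suc p * ?v ^ Suc q)
       = smult (of_nat (Suc q)) (?u ^ Suc p * ?v ^ q) + smult (of_nat (Suc p)) (?v ^ Suc q * ?u ^ p)"
      by (simp only: pderiv_mult pderiv_power_Suc mult_1_right mult_smult_right)
    then show ?thesis by (simp only: mult.commute add.commute)
  qed
  from segment_integral_pderiv[of \<alpha> \<beta> "?u ^ Suc p * ?v ^ Suc q", unfolded this]
  have "of_nat (Suc p) * segment_integral \<alpha> \<beta> (?u ^ p * ?v ^ Suc q) + of_nat (Suc q) * segment_integral \<alpha> \<beta> (?u ^ Suc p * ?v ^ q) = 0"
    by (simp add: segment_integral_add segment_integral_smult poly_power del: of_nat_Suc)
  then have "segment_integral \<alpha> \<beta> (?u ^ Suc p * ?v ^ q) = - (of_nat (Suc p) * segment_integral \<alpha> \<beta> (?u ^ p * ?v ^ Suc q) / of_nat (Suc q))"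
    by (simp add: field_simps add_eq_0_iff del: of_nat_Suc power_Suc)
  also have "segment_integral \<alpha> \<beta> (?u ^ p * ?v ^ Suc q) =
     (-1) ^ Suc q * (\<beta> - \<alpha>) ^ (p + Suc q + 1) * (fact p * fact (Suc q) / fact (p + Suc q + 1))"
    by (rule Suc.IH)
  finally have e: "segment_integral \<alpha> \<beta> (?u ^ Suc p * ?v ^ q) = - (of_nat (Suc p) * ((-1) ^ Suc q *
     (\<beta> - \<alpha>) ^ (p + Suc q + 1) * (fact p * fact (Suc q) / fact (p + Suc q + 1))) / of_nat (Suc q))" .
  have alg: "- (c * ((-1) ^ Suc q * d * (f * (e * g) / h)) / e) = (-1) ^ q * d * ((c * f) * g / h)"
    if "e \<noteq> 0" for c d e f g h :: complex
    using that by (cases "h = 0") (simp_all add: field_simps)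
  have "p + Suc q + 1 = Suc p + q + 1" by simp
  then show ?case
    unfolding e fact_Suc[of p] fact_Suc[of q] by (simp only: alg[of "of_nat (Suc q)"] of_nat_neq_0 not_False_eq_True)
qed

text \<open>
  The Pade numerators and denominators of binomial functions, as a binary form of degree r with
  nonnegative integer coefficients. Up to a power of Z and a sign, it is the integral of (u -
  \<alpha>)^p (u - \<beta>)^q (u - \<gamma>)^r along the segment from \<alpha> to \<beta>, with X
  = \<beta> - \<gamma> and Z = \<alpha> - \<beta>, normalised by a multinomial coefficient that
  clears the denominators of the beta integrals.
\<close>

definition pade_poly :: "nat \<Rightarrow> nat \<Rightarrow> nat \<Rightarrow> 'a :: comm_ring_1 \<Rightarrow> 'a \<Rightarrow> 'a" where
  "pade_poly p q r X Z = (\<Sum>j\<le>r. of_nat ((p + q + r + 1) choose (r - j)) * of_nat ((q + j) choose j) * X ^ (r - j) * Z ^ j)"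

lemma pade_coefficient:
  assumes "j \<le> r"
  shows "of_nat (r choose j) * (fact p * fact (q + j) / fact (p + (q + j) + 1)) * (fact (p + q + r + 1) / (fact p * fact q * fact r))
    = (of_nat ((p + q + r + 1) choose (r - j)) * of_nat ((q + j) choose j) :: complex)"
proof -
  have e: "p + q + r + 1 - (r - j) = p + (q + j) + 1" using assms by simp
  have 1: "(of_nat (r choose j) :: complex) = fact r / (fact j * fact (r - j))"
    using assms by (rule binomial_fact)
  have 2: "(of_nat ((p + q + r + 1) choose (r - j)) :: complex)
     = fact (p + q + r + 1) / (fact (r - j) * fact (p + (q + j) + 1))"
    by (subst binomial_fact) (use e in auto)
  have 3: "(of_nat ((q + j) choose j) :: complex) = fact (q + j) / (fact j * fact q)"
    by (subst binomial_fact) auto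
  show ?thesis unfolding 1 2 3 by (simp del: fact_Suc add: mult_ac)
qed

text \<open>
  Expanding (u - \<gamma>)^r around \<beta> reduces the integral to beta integrals. Since the
  normalising factor is symmetric in the three pairs (p, \<alpha>), (q, \<beta>), (r, \<gamma>),
  the same formula serves all three sides of the triangle.
\<close>

lemma segment_integral_pade:
  assumes "X = \<beta> - \<gamma>" "Z = \<alpha> - \<beta>"
  shows "fact (p + q + r + 1) / (fact p * fact q * fact r) *
    segment_integral \<alpha> \<beta> ([:-\<alpha>, 1:] ^ p * [:-\<beta>, 1:] ^ q * [:-\<gamma>, 1:] ^ r)
     = (-1) ^ (p + 1) * Z ^ (p + q + 1) * pade_poly p q r X Z"
proof -
  let ?u = "[:-\<alpha>, 1:]" and ?v = "[:-\<beta>, 1:]" and ?w = "[:-\<gamma>, 1:]"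
  let ?K = "fact (p + q + r + 1) / (fact p * fact q * fact r) :: complex"
  have w: "?w = ?v + [:X:]" using assms by simp
  have "?w ^ r = (\<Sum>j\<le>r. smult (of_nat (r choose j) * X ^ (r - j)) (?v ^ j))"
    unfolding w binomial_ring by (simp add: poly_const_pow of_nat_poly mult_ac)
  then have "?u ^ p * ?v ^ q * ?w ^ r
     = (\<Sum>j\<le>r. smult (of_nat (r choose j) * X ^ (r - j)) (?u ^ p * ?v ^ (q + j)))"
    by (simp add: sum_distrib_left power_add mult_ac)
  then have "?K * segment_integral \<alpha> \<beta> (?u ^ p * ?v ^ q * ?w ^ r)
     = (\<Sum>j\<le>r. ?K * (of_nat (r choose j) * X ^ (r - j) *
          ((-1) ^ (q + j) * (\<beta> - \<alpha>) ^ (p + (q + j) + 1) * (fact p * fact (q + j) / fact (p + (q + j) + 1)))))"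
    by (simp only: segment_integral_sum segment_integral_smult segment_integral_beta sum_distrib_left)
  also have "\<dots> = (\<Sum>j\<le>r. (-1) ^ (p + 1) * Z ^ (p + q + 1) *
      (of_nat ((p + q + r + 1) choose (r - j)) * of_nat ((q + j) choose j) * X ^ (r - j) * Z ^ j))"
  proof (rule sum.cong[OF refl])
    fix j assume j: "j \<in> {..r}"
    have "(\<beta> - \<alpha>) ^ (p + (q + j) + 1) = (-1) ^ (p + (q + j) + 1) * Z ^ (p + (q + j) + 1)"
      unfolding assms by (subst power_mult_distrib[symmetric]) simp
    then have s: "(-1) ^ (q + j) * (\<beta> - \<alpha>) ^ (p + (q + j) + 1) = (-1) ^ (p + 1) * Z ^ (p + q + 1) * Z ^ j"
      by (simp add: power_add mult_ac power_mult_distrib[symmetric] flip: power_mult_distrib)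
    have "?K * (of_nat (r choose j) * X ^ (r - j) *
          ((-1) ^ (q + j) * (\<beta> - \<alpha>) ^ (p + (q + j) + 1) * (fact p * fact (q + j) / fact (p + (q + j) + 1))))
       = (of_nat (r choose j) * (fact p * fact (q + j) / fact (p + (q + j) + 1)) * ?K) * X ^ (r - j) *
           ((-1) ^ (q + j) * (\<beta> - \<alpha>) ^ (p + (q + j) + 1))"
      by (simp only: mult_ac)
    also have "\<dots> = (of_nat ((p + q + r + 1) choose (r - j)) * of_nat ((q + j) choose j)) * X ^ (r - j) *
         ((-1) ^ (p + 1) * Z ^ (p + q + 1) * Z ^ j)"
      using j by (subst pade_coefficient, simp) (simp only: s)
    finally show "?K * (of_nat (r choose j) * X ^ (r - j) *
          ((-1) ^ (q + j) * (\<beta> - \<alpha>) ^ (p + (q + j) + 1) * (fact p * fact (q + j) / fact (p + (q + j) + 1))))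
      = (-1) ^ (p + 1) * Z ^ (p + q + 1) *
      (of_nat ((p + q + r + 1) choose (r - j)) * of_nat ((q + j) choose j) * X ^ (r - j) * Z ^ j)"
      by (simp only: mult_ac)
  qed
  also have "\<dots> = (-1) ^ (p + 1) * Z ^ (p + q + 1) * pade_poly p q r X Z"
    unfolding pade_poly_def by (simp only: sum_distrib_left)
  finally show ?thesis .
qed

definition pade_term :: "nat \<Rightarrow> nat \<Rightarrow> nat \<Rightarrow> 'a :: comm_ring_1 \<Rightarrow> 'a \<Rightarrow> 'a" where
  "pade_term p q r X Z = (-1) ^ (p + 1) * Z ^ (p + q + 1) * pade_poly p q r X Z"

text \<open>
  The three summands are, up to a common factor, the integrals of one polynomial along the three
  sides of the triangle with vertices \<alpha>, \<beta>, \<gamma>, and X, Y, Z are the differences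
  of these vertices.
\<close>

lemma pade_identity:
  fixes X Y Z :: complex
  assumes "X + Y + Z = 0"
  shows "pade_term p q r X Z + pade_term q r p Y X + pade_term r p q Z Y = 0"
proof -
  define \<alpha> \<beta> \<gamma> where "\<alpha> = (0 :: complex)" and "\<beta> = - Z" and "\<gamma> = Y"
  have *: "X = \<beta> - \<gamma>" "Y = \<gamma> - \<alpha>" "Z = \<alpha> - \<beta>"
    using assms by (auto simp: \<alpha>_def \<beta>_def \<gamma>_def algebra_simps eq_neg_iff_add_eq_0)
  let ?u = "[:-\<alpha>, 1:] ^ p" and ?v = "[:-\<beta>, 1:] ^ q" and ?w = "[:-\<gamma>, 1:] ^ r"
  let ?K = "fact (p + q + r + 1) / (fact p * fact q * fact r) :: complex"
  have "?K * (segment_integral \<alpha> \<beta> (?u * ?v * ?w) + segment_integral \<beta> \<gamma> (?u * ?v * ?w) + segment_integral \<gamma> \<alpha> (?u * ?v * ?w)) = 0"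
    by (simp only: segment_integral_cycle mult_zero_right)
  moreover have "?K * segment_integral \<alpha> \<beta> (?u * ?v * ?w) = pade_term p q r X Z"
    unfolding pade_term_def by (rule segment_integral_pade) (use * in auto)
  moreover have "?K * segment_integral \<beta> \<gamma> (?u * ?v * ?w) = pade_term q r p Y X"
    using segment_integral_pade[of Y \<gamma> \<alpha> X \<beta> q r p] * unfolding pade_term_def by (simp add: mult_ac add_ac)
  moreover have "?K * segment_integral \<gamma> \<alpha> (?u * ?v * ?w) = pade_term r p q Z Y"
    using segment_integral_pade[of Z \<alpha> \<beta> Y \<gamma> r p q] * unfolding pade_term_def by (simp add: mult_ac add_ac)
  ultimately show ?thesis by (simp only: distrib_left)
qed


lemma poly_pade_poly: "poly (pade_poly p q r F G) t = pade_poly p q r (poly F t) (poly G t)"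
  unfolding pade_poly_def by (simp add: poly_sum)

lemma poly_pade_term: "poly (pade_term p q r F G) t = pade_term p q r (poly F t) (poly G t)"
  unfolding pade_term_def by (simp add: poly_pade_poly)

lemma pade_poly_zero_left: "pade_poly p q r 0 Z = of_nat ((q + r) choose r) * Z ^ r"
proof -
  have "pade_poly p q r 0 Z = (\<Sum>j\<in>{r}. of_nat ((p + q + r + 1) choose (r - j)) * of_nat ((q + j) choose j) * 0 ^ (r - j) * Z ^ j)"
    unfolding pade_poly_def by (rule sum.mono_neutral_right) (auto simp: power_0_left)
  then show ?thesis by simp
qed

lemma pade_poly_zero_right: "pade_poly p q r X 0 = of_nat ((p + q + r + 1) choose r) * X ^ r"
proof -
  have "pade_poly p q r X 0 = (\<Sum>j\<in>{0}. of_nat ((p + q + r + 1) choose (r - j)) * of_nat ((q + j) choose j) * X ^ (r - j) * 0 ^ j)"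
    unfolding pade_poly_def by (rule sum.mono_neutral_right) (auto simp: power_0_left)
  then show ?thesis by simp
qed

lemma degree_pade_poly:
  fixes F G :: "complex poly"
  assumes "degree F \<le> 1" "degree G \<le> 1"
  shows "degree (pade_poly p q r F G) \<le> r"
  unfolding pade_poly_def
proof (rule degree_sum_le)
  fix j assume j: "j \<in> {..r}"
  let ?c = "of_nat ((p + q + r + 1) choose (r - j)) * of_nat ((q + j) choose j) :: complex poly"
  have "degree (F ^ (r - j)) \<le> 1 * (r - j)" "degree (G ^ j) \<le> 1 * j"
    using degree_power_le[of F "r - j"] degree_power_le[of G j] assms
    by (meson mult_le_mono1 order_trans)+
  moreover have "degree (?c * F ^ (r - j) * G ^ j) \<le> degree ?c + degree (F ^ (r - j)) + degree (G ^ j)"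
    using degree_mult_le[of "?c * F ^ (r - j)" "G ^ j"] degree_mult_le[of ?c "F ^ (r - j)"] by linarith
  moreover have "degree ?c = 0"
    unfolding of_nat_mult[symmetric] by (rule degree_of_nat)
  ultimately show "degree (?c * F ^ (r - j) * G ^ j) \<le> r"
    using j by auto
qed simp

text \<open>
  Let D be the difference of the two sides, as a polynomial in t; here Z = 1, Y = t and X = -1 -
  t, and the two Pade systems are those for the exponents (p+1, p, r) and (p, p+1, r). Put M = p +
  r + 1. Both systems have their Y-component divisible by t^M. As the components of each system
  have sum 0, D can also be written with the X-components, which are divisible by X^M. The degree
  of D is at most 2 M, so D is a constant multiple of t^M X^M, and the constant is nonzero because
  only one of the two Y-components is divisible by t^(M+1), and the Z-component with which the
  other one is multiplied does not vanish at t = 0.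
\<close>

lemma pade_nondegenerate:
  fixes t :: complex
  assumes t: "t \<noteq> 0" "t \<noteq> - 1"
  shows "pade_term (p + 1) p r (- 1 - t) 1 * pade_term r p (p + 1) 1 t \<noteq> pade_term r (p + 1) p 1 t * pade_term p (p + 1) r (- 1 - t) 1"
proof -
  define T X :: "complex poly" where "T = [:0, 1:]" and "X = [:-1, -1:]"
  define M where "M = p + r + 1"
  have TX: "T + X = -1" by (simp add: T_def X_def one_pCons)
  have T_eval [simp]: "poly T s = s" and X_eval [simp]: "poly X s = - 1 - s" for s
    by (auto simp: T_def X_def)
  define vX vY vZ where "vX = pade_term p r (p + 1) T X" and "vY = pade_term r (p + 1) p 1 T" and "vZ = pade_term (p + 1) p r X 1"
  define uX uY uZ where "uX = pade_term (p + 1) r p T X" and "uY = pade_term r p (p + 1) 1 T" and "uZ = pade_term p (p + 1) r X 1"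
  have v0: "vZ + vX + vY = 0"
  proof (rule poly_eq_poly_eq_iff[THEN iffD1], rule ext)
    fix s show "poly (vZ + vX + vY) s = poly 0 s"
      unfolding vX_def vY_def vZ_def using pade_identity[of "-1 - s" s 1 "p + 1" p r] by (simp add: poly_pade_term)
  qed
  have u0: "uZ + uX + uY = 0"
  proof (rule poly_eq_poly_eq_iff[THEN iffD1], rule ext)
    fix s show "poly (uZ + uX + uY) s = poly 0 s"
      unfolding uX_def uY_def uZ_def using pade_identity[of "-1 - s" s 1 p "p + 1" r] by (simp add: poly_pade_term)
  qed
  define D where "D = vZ * uY - vY * uZ"
  define w w' where "w = (-1) ^ (r + 1) * pade_poly r (p + 1) p 1 T" and "w' = (-1) ^ (r + 1) * pade_poly r p (p + 1) 1 T"
  have vY: "vY = T ^ M * (T * w)" unfolding vY_def pade_term_def w_def M_def by (simp add: algebra_simps power_add)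
  have uY: "uY = T ^ M * w'" unfolding uY_def pade_term_def w'_def M_def by (simp add: algebra_simps power_add)
  have D1: "D = T ^ M * (vZ * w' - T * w * uZ)" unfolding D_def vY uY by (simp add: algebra_simps)
  have sums: "vY = - vX - vZ" "uY = - uX - uZ"
    using v0 u0 by (simp_all add: algebra_simps eq_neg_iff_add_eq_0)
  have D2: "D = vX * uZ - vZ * uX" unfolding D_def sums by (simp add: algebra_simps)
  have "X ^ M dvd vX" "X ^ M dvd uX" unfolding vX_def uX_def pade_term_def M_def by (simp_all add: power_add add_ac mult_ac)
  then have "X ^ M dvd D" unfolding D2 by simp
  moreover have "T ^ M dvd D" unfolding D1 by simp
  moreover have "coprime (T ^ M) (X ^ M)"
  proof -
    have "coprime T X"
    proof (rule coprimeI)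
      fix d assume "d dvd T" "d dvd X"
      then have "d dvd T + X" by (rule dvd_add)
      then show "d dvd 1" unfolding TX by simp
    qed
    then show ?thesis by simp
  qed
  ultimately have "T ^ M * X ^ M dvd D" by (intro divides_mult)
  then obtain Q where Q: "D = T ^ M * X ^ M * Q" by (rule dvdE)
  have T0: "T \<noteq> 0" "X \<noteq> 0" by (auto simp: T_def X_def)
  have "T ^ M * (X ^ M * Q) = T ^ M * (vZ * w' - T * w * uZ)" using D1 Q by (simp add: mult_ac)
  then have "X ^ M * Q = vZ * w' - T * w * uZ" using T0 by simp
  then have "poly (X ^ M * Q) 0 = poly (vZ * w' - T * w * uZ) 0" by simp
  then have Q0: "(-1) ^ M * poly Q 0 = poly vZ 0 * poly w' 0" by simp
  \<comment> \<open>Both constant terms are single binomial coefficients up to sign; for the Z-component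
    this is seen on the X-component, as the Y-component vanishes at 0.\<close>
  have "poly w' 0 \<noteq> 0" unfolding w'_def by (simp add: poly_pade_poly pade_poly_zero_right del: binomial_Suc_Suc)
  moreover have "poly vZ 0 \<noteq> 0"
  proof -
    have "poly vY 0 = 0" unfolding vY M_def by simp
    moreover have "poly vX 0 \<noteq> 0" unfolding vX_def by (simp add: poly_pade_term poly_pade_poly pade_term_def pade_poly_zero_left del: binomial_Suc_Suc)
    moreover have "poly (vZ + vX + vY) 0 = 0" unfolding v0 by simp
    ultimately show ?thesis by auto
  qed
  ultimately have "Q \<noteq> 0" using Q0 by auto
  have deg: "degree T = 1" "degree X = 1" by (auto simp: T_def X_def)
  have "degree D = M + M + degree Q"
    unfolding Q using T0 \<open>Q \<noteq> 0\<close> deg by (simp add: degree_mult_eq degree_power_eq)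
  moreover have "degree D \<le> M + M"
  proof -
    have dp: "degree ((-1) ^ n * F) = degree F" for n and F :: "complex poly"
      by (cases "even n") simp_all
    have z: "degree vZ \<le> r" "degree uZ \<le> r"
      unfolding vZ_def uZ_def pade_term_def using deg degree_pade_poly[of X 1] by (simp_all add: dp mult.assoc del: power_Suc)
    have "degree (T ^ n * pade_poly r a b 1 T) \<le> n + b" for n a b
    proof -
      have "degree (T ^ n * pade_poly r a b 1 T) \<le> degree (T ^ n) + degree (pade_poly r a b 1 T)" by (rule degree_mult_le)
      also have "\<dots> \<le> n + b" using degree_pade_poly[of 1 T r a b] T0 deg by (simp add: degree_power_eq)
      finally show ?thesis .
    qed
    note this[of "r + (p + 1) + 1" "p + 1" p] this[of "r + p + 1" p "p + 1"]
    then have y: "degree vY \<le> r + 2 * p + 2" "degree uY \<le> r + 2 * p + 2"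
      unfolding vY_def uY_def pade_term_def by (simp_all add: dp mult.assoc del: power_Suc)
    have "degree (vZ * uY) \<le> M + M" "degree (vY * uZ) \<le> M + M"
      using degree_mult_le[of vZ uY] degree_mult_le[of vY uZ] y z unfolding M_def by linarith+
    then show ?thesis unfolding D_def by (rule degree_diff_le)
  qed
  ultimately have "degree Q = 0" by simp
  then obtain c where c: "Q = [:c:]" by (rule degree_eq_zeroE)
  have "poly D t \<noteq> 0"
    unfolding Q c using t \<open>Q \<noteq> 0\<close> c by (auto simp: eq_neg_iff_add_eq_0 algebra_simps)
  then show ?thesis
    unfolding D_def vZ_def uY_def vY_def uZ_def by (simp add: poly_pade_term)
qed

section \<open>Conjugates of an algebraic number\<close>

text \<open>
  Evaluation of rational polynomials at complex numbers; its image for fixed z is the ring Q[z].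
\<close>

definition qeval :: "rat poly \<Rightarrow> complex \<Rightarrow> complex" where
  "qeval p z = poly (map_poly of_rat p) z"

lemma qeval_0 [simp]: "qeval 0 z = 0"
  and qeval_pCons [simp]: "qeval (pCons c p) z = of_rat c + z * qeval p z"
  by (simp_all add: qeval_def map_poly_pCons)

lemma qeval_1 [simp]: "qeval 1 z = 1"
  using qeval_pCons[of 1 0 z] by (simp add: one_pCons)

lemma qeval_add [simp]: "qeval (p + q) z = qeval p z + qeval q z"
  by (induction p q rule: poly_induct2) (simp_all add: of_rat_add algebra_simps)

lemma qeval_smult [simp]: "qeval (smult c p) z = of_rat c * qeval p z"
  by (induction p) (simp_all add: of_rat_mult algebra_simps)

lemma qeval_mult [simp]: "qeval (p * q) z = qeval p z * qeval q z"
  by (induction p) (simp_all add: algebra_simps)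

lemma qeval_minus [simp]: "qeval (- p) z = - qeval p z"
  using qeval_smult[of "-1" p z] by (simp add: of_rat_minus)

lemma qeval_diff [simp]: "qeval (p - q) z = qeval p z - qeval q z"
  using qeval_add[of p "- q" z] by simp

lemma qeval_power [simp]: "qeval (p ^ n) z = qeval p z ^ n"
  by (induction n) simp_all

lemma qeval_dvd: "p dvd q \<Longrightarrow> qeval p z = 0 \<Longrightarrow> qeval q z = 0"
  by (auto elim: dvdE)

lemma minimal_polynomial_exists:
  assumes "F0 \<noteq> 0" "qeval F0 x = 0"
  obtains m where "m \<noteq> 0" "\<And>F. qeval F x = 0 \<longleftrightarrow> m dvd F"
proof -
  define P where "P m \<longleftrightarrow> m \<noteq> 0 \<and> qeval m x = 0" for m
  obtain m where m: "P m" "\<And>F. P F \<Longrightarrow> degree m \<le> degree F"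
    using assms ex_has_least_nat[of P F0 degree] unfolding P_def by blast
  have "m dvd F" if F: "qeval F x = 0" for F
  proof (rule ccontr)
    assume n: "\<not> m dvd F"
    have "qeval (F mod m) x = 0"
      using F m(1) unfolding P_def minus_div_mult_eq_mod[symmetric] by simp
    moreover have "F mod m \<noteq> 0" using n by (simp add: dvd_eq_mod_eq_0)
    ultimately have "degree m \<le> degree (F mod m)" using m(2) unfolding P_def by blast
    moreover have "degree (F mod m) < degree m"
      using degree_mod_less[of m F] m(1) n by (auto simp: P_def dvd_eq_mod_eq_0)
    ultimately show False by simp
  qed
  then show ?thesis using m(1) that qeval_dvd unfolding P_def by blast
qed

text \<open>
  The minimal polynomial is irreducible, so it is coprime to every polynomial that does not vanish
  at x.
\<close>

lemma minimal_polynomial_bezout: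
  assumes m: "m \<noteq> 0" "\<And>F. qeval F x = 0 \<longleftrightarrow> m dvd F" and F: "qeval F x \<noteq> 0"
  obtains u v where "u * m + v * F = 1"
proof -
  obtain h where h: "m = gcd m F * h" using gcd_dvd1[of m F] by (rule dvdE)
  have "qeval (gcd m F) x \<noteq> 0" using F qeval_dvd[OF gcd_dvd2] by blast
  moreover have "qeval m x = 0" using m(2) by simp
  ultimately have "qeval h x = 0" using h by (metis mult_eq_0_iff qeval_mult)
  then have "gcd m F * h dvd 1 * h" using m(2) h by simp
  then have "gcd m F dvd 1" using m(1) h by (metis dvd_times_right_cancel_iff mult_zero_right)
  then have "gcd m F = 1" using coprime_iff_gcd_eq_1 is_unit_gcd by blast
  moreover have "fst (bezout_coefficients m F) * m + snd (bezout_coefficients m F) * F = gcd m F"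
    by (rule bezout_coefficients_fst_snd)
  ultimately show ?thesis using that by metis
qed

lemma qeval_inverse:
  assumes "F0 \<noteq> 0" "qeval F0 x = 0" "qeval F x \<noteq> 0"
  obtains G where "qeval F x * qeval G x = 1"
proof -
  obtain m where m: "m \<noteq> 0" "\<And>F. qeval F x = 0 \<longleftrightarrow> m dvd F"
    using minimal_polynomial_exists[OF assms(1,2)] by blast
  obtain u v where "u * m + v * F = 1" using minimal_polynomial_bezout[OF m assms(3)] by blast
  then have "qeval (u * m + v * F) x = qeval 1 x" by simp
  then have "qeval F x * qeval v x = 1" using m(2)[of m] by (simp add: mult.commute)
  then show ?thesis using that by blast
qed

text \<open>
  For algebraic x this says that s is a root of the minimal polynomial of x. In this form, every
  polynomial relation that holds at x is inherited by s at once.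
\<close>

definition conjugate :: "complex \<Rightarrow> complex \<Rightarrow> bool" where
  "conjugate x s \<longleftrightarrow> (\<forall>F. qeval F x = 0 \<longrightarrow> qeval F s = 0)"

text \<open>
  The derivative of the minimal polynomial has smaller degree, so it does not vanish at x; by the
  Bezout identity the minimal polynomial then has no multiple root.
\<close>

lemma card_roots_minimal_polynomial:
  assumes m: "m \<noteq> 0" "\<And>F. qeval F x = 0 \<longleftrightarrow> m dvd F"
  shows "card {s. qeval m s = 0} = degree m"
proof -
  define mc :: "complex poly" where "mc = map_poly of_rat m"
  have pd: "poly (pderiv mc) s = qeval (pderiv m) s" for s
  proof -
    have "pderiv mc = map_poly of_rat (pderiv m)"
      unfolding mc_def by (rule poly_eqI) (simp add: coeff_pderiv coeff_map_poly of_rat_mult of_rat_add)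
    then show ?thesis by (simp add: qeval_def)
  qed
  have "qeval m x = 0" using m(2) by simp
  then have "degree m \<noteq> 0" using m(1) by (intro notI) (auto elim!: degree_eq_zeroE)
  then have "\<not> m dvd pderiv m" by (rule not_dvd_pderiv)
  then have "qeval (pderiv m) x \<noteq> 0" using m(2) by blast
  then obtain u v where uv: "u * m + v * pderiv m = 1" using minimal_polynomial_bezout[OF m] by blast
  have "rsquarefree mc"
    unfolding rsquarefree_roots
  proof (intro allI notI)
    fix a assume "poly mc a = 0 \<and> poly (pderiv mc) a = 0"
    then have "qeval m a = 0" "qeval (pderiv m) a = 0" using pd by (auto simp: qeval_def mc_def)
    then have "qeval (u * m + v * pderiv m) a = 0" by simp
    then show False unfolding uv by simp
  qed
  then have "mc = smult (lead_coeff mc) (\<Prod>z\<in>{z. poly mc z = 0}. [:-z, 1:])"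
    using complex_poly_decompose_rsquarefree[of mc] by simp
  moreover have "mc \<noteq> 0" using m(1) unfolding mc_def by (simp add: map_poly_eq_0_iff)
  ultimately have "degree mc = degree (\<Prod>z\<in>{z. poly mc z = 0}. [:-z, 1:])"
    by (metis degree_smult_eq leading_coeff_0_iff)
  also have "\<dots> = (\<Sum>z\<in>{z. poly mc z = 0}. degree [:-z, 1:])"
    by (rule degree_prod_eq_sum_degree) simp
  finally have "degree mc = card {z. poly mc z = 0}" by simp
  moreover have "degree mc = degree m" unfolding mc_def by (rule degree_map_poly) simp
  ultimately show ?thesis by (simp add: qeval_def mc_def)
qed

lemma lagrange_interpolation:
  fixes q :: "complex poly"
  assumes A: "finite A" "degree q < card A"
  defines "l \<equiv> \<lambda>s. \<Prod>r\<in>A - {s}. [:-r, 1:]"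
  shows "q = (\<Sum>s\<in>A. smult (poly q s / poly (l s) s) (l s))"
proof (rule poly_eqI_degree[of A])
  have deg: "degree (l s) < card A" if "s \<in> A" for s
  proof -
    have "degree (l s) = (\<Sum>r\<in>A - {s}. degree [:-r, 1:])"
      unfolding l_def by (rule degree_prod_eq_sum_degree) simp
    also have "\<dots> = card (A - {s})" by simp
    also have "\<dots> < card A" using that A by (simp add: card_Diff1_less)
    finally show ?thesis .
  qed
  have "degree (\<Sum>s\<in>A. smult (poly q s / poly (l s) s) (l s)) \<le> card A - 1"
  proof (rule degree_sum_le[OF A(1)])
    fix s assume "s \<in> A"
    have "degree (smult (poly q s / poly (l s) s) (l s)) \<le> degree (l s)" by (rule degree_smult_le)
    then show "degree (smult (poly q s / poly (l s) s) (l s)) \<le> card A - 1" using deg[OF \<open>s \<in> A\<close>] by simp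
  qed
  then show "degree (\<Sum>s\<in>A. smult (poly q s / poly (l s) s) (l s)) < card A"
    using A(2) by simp
  fix t assume t: "t \<in> A"
  have 0: "poly (l s) t = 0" if "s \<noteq> t" for s
    unfolding l_def poly_prod using that t A(1) by (intro prod_zero bexI[of _ t]) auto
  have 1: "poly (l t) t \<noteq> 0"
    unfolding l_def poly_prod using A(1) by (simp add: prod_zero_iff)
  have "poly (\<Sum>s\<in>A. smult (poly q s / poly (l s) s) (l s)) t
     = (\<Sum>s\<in>A. poly q s / poly (l s) s * poly (l s) t)" by (simp add: poly_sum)
  also have "\<dots> = (\<Sum>s\<in>{t}. poly q s / poly (l s) s * poly (l s) t)"
    using A(1) t 0 by (intro sum.mono_neutral_right) auto
  also have "\<dots> = poly q t" using 1 by simp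
  finally show "poly q t = poly (\<Sum>s\<in>A. smult (poly q s / poly (l s) s) (l s)) t" by simp
qed (use A in auto)


section \<open>Finitely generated groups of algebraic numbers\<close>

text \<open>
  The subgroup of the complex numbers that is generated by B.
\<close>

inductive_set zspan :: "complex set \<Rightarrow> complex set" for B where
  zero: "0 \<in> zspan B"
| step: "b \<in> B \<Longrightarrow> s \<in> zspan B \<Longrightarrow> of_int k * b + s \<in> zspan B"

lemma zspan_base: "b \<in> B \<Longrightarrow> b \<in> zspan B"
  using zspan.step[OF _ zspan.zero, of b B 1] by simp

lemma zspan_add: "s \<in> zspan B \<Longrightarrow> t \<in> zspan B \<Longrightarrow> s + t \<in> zspan B"
  by (induction rule: zspan.induct) (auto simp: add.assoc intro: zspan.step)

lemma zspan_scale: "s \<in> zspan B \<Longrightarrow> of_int c * s \<in> zspan B"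
proof (induction rule: zspan.induct)
  case (step b s k)
  then show ?case using zspan.step[of b B "of_int c * s" "c * k"] by (simp add: algebra_simps)
qed (simp add: zspan.zero)

lemma zspan_mult_left:
  assumes "\<And>b. b \<in> B \<Longrightarrow> f * b \<in> zspan E" "s \<in> zspan B"
  shows "f * s \<in> zspan E"
  using assms(2)
proof (induction rule: zspan.induct)
  case (step b s k)
  have "f * (of_int k * b + s) = of_int k * (f * b) + f * s" by (simp add: algebra_simps)
  then show ?case using assms(1) step zspan_add zspan_scale by simp
qed (simp add: zspan.zero)

lemma common_denominator:
  assumes "finite R"
  shows "\<exists>L::int. L > 0 \<and> (\<forall>r::rat\<in>R. of_int L * r \<in> \<int>)"
  using assms
proof (induction R rule: finite_induct)
  case empty
  then show ?case by (auto intro: exI[of _ 1])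
next
  case (insert r R)
  then obtain L where L: "L > 0" "\<forall>r\<in>R. of_int L * r \<in> \<int>" by blast
  obtain a b where r: "r = of_int a / of_int b" "b > 0"
    by (metis quotient_of_div quotient_of_denom_pos surj_pair)
  have "of_int (L * b) * s \<in> \<int>" if "s \<in> insert r R" for s
  proof (cases "s = r")
    case True
    then have "of_int (L * b) * s = of_int (L * a)" using r by simp
    then show ?thesis by (metis Ints_of_int)
  next
    case False
    then have "of_int b * (of_int L * s) \<in> \<int>" using that L(2) False by (intro Ints_mult[OF Ints_of_int, of "of_int L * s" b]) auto
    then show ?thesis by (simp add: mult_ac)
  qed
  then show ?case using L(1) r(2) by (intro exI[of _ "L * b"]) auto
qed

text \<open>
  This replaces the norm argument "a nonzero algebraic integer has a conjugate of absolute value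
  at least 1". Write the n-th power of h(x) as q_n(x) with q_n rational of degree less than that
  of the minimal polynomial. As these powers lie in a finitely generated group, the q_n have a
  common denominator. Their values at the conjugates of x are the powers of the conjugates of h(x)
  and tend to 0, hence so do their coefficients, by Lagrange interpolation. Numbers with bounded
  denominator that tend to 0 are eventually 0.
\<close>

lemma small_conjugates_imp_zero:
  assumes alg: "F0 \<noteq> 0" "qeval F0 x = 0"
    and B: "finite B" "\<And>n. qeval h x ^ n \<in> zspan ((\<lambda>w. qeval w x) ` B)"
    and small: "\<And>s. conjugate x s \<Longrightarrow> norm (qeval h s) < 1"
  shows "qeval h x = 0"
proof -
  obtain m where m: "m \<noteq> 0" "\<And>F. qeval F x = 0 \<longleftrightarrow> m dvd F"
    using minimal_polynomial_exists[OF alg] by blast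
  define A where "A = {s. qeval m s = 0}"
  have card: "card A = degree m" unfolding A_def by (rule card_roots_minimal_polynomial[OF m])
  have "qeval m x = 0" using m(2) by simp
  then have deg: "degree m > 0" using m(1) by (auto elim!: degree_eq_zeroE intro: gr0I)
  then have finA: "finite A" using card by (metis card.infinite less_not_refl)
  have conjA: "conjugate x s" if "s \<in> A" for s
    using that m(2) qeval_dvd unfolding conjugate_def A_def by blast
  let ?R = "(\<lambda>(w, i). coeff (w mod m) i) ` (B \<times> {..<degree m})"
  have "finite ?R" using B(1) by simp
  from common_denominator[OF this] obtain L :: int where L: "L > 0" "\<forall>r\<in>?R. of_int L * r \<in> \<int>" by blast
  \<comment> \<open>Reducing the generators modulo the minimal polynomial first keeps L independent of the element.\<close>
  have rep: "\<exists>q. degree q < degree m \<and> (\<forall>i. of_int L * coeff q i \<in> \<int>) \<and> qeval q x = z"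
    if "z \<in> zspan ((\<lambda>w. qeval w x) ` B)" for z
    using that
  proof (induction rule: zspan.induct)
    case zero
    show ?case using deg by (intro exI[of _ 0]) simp
  next
    case (step b s k)
    then obtain w q where w: "w \<in> B" "b = qeval w x"
      and q: "degree q < degree m" "\<forall>i. of_int L * coeff q i \<in> \<int>" "qeval q x = s" by blast
    let ?q = "smult (of_int k) (w mod m) + q"
    have dw: "degree (w mod m) < degree m"
      using degree_mod_less[of m w] m(1) deg by (cases "w mod m = 0") auto
    have iw: "of_int L * coeff (w mod m) i \<in> \<int>" for i
    proof (cases "i < degree m")
      case True
      then show ?thesis using L(2) w(1) by force
    next
      case False
      then show ?thesis using dw by (simp add: coeff_eq_0)
    qed
    have "degree ?q < degree m"
      using dw q(1) degree_smult_le[of "of_int k" "w mod m"] by (intro degree_add_less) linarith+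
    moreover have "of_int L * coeff ?q i \<in> \<int>" for i
    proof -
      have "of_int L * coeff ?q i = of_int k * (of_int L * coeff (w mod m) i) + of_int L * coeff q i"
        by (simp add: algebra_simps)
      then show ?thesis using iw q(2) by simp
    qed
    moreover have "qeval ?q x = of_int k * b + s"
    proof -
      have "qeval (w mod m) x = qeval w x"
        using \<open>qeval m x = 0\<close> unfolding minus_div_mult_eq_mod[symmetric] by simp
      then show ?thesis using w q by simp
    qed
    ultimately show ?case by blast
  qed
  then have "\<forall>n. \<exists>q. degree q < degree m \<and> (\<forall>i. of_int L * coeff q i \<in> \<int>) \<and> qeval q x = qeval h x ^ n"
    using B(2) by blast
  then obtain q where q: "\<And>n. degree (q n) < degree m" "\<And>n i. of_int L * coeff (q n) i \<in> \<int>"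
      "\<And>n. qeval (q n) x = qeval h x ^ n" by metis
  have qs: "qeval (q n) s = qeval h s ^ n" if "s \<in> A" for n s
  proof -
    have "qeval (q n - h ^ n) x = 0" using q(3) by simp
    then have "qeval (q n - h ^ n) s = 0" using conjA[OF that] unfolding conjugate_def by blast
    then show ?thesis by simp
  qed
  define l where "l = (\<lambda>s. \<Prod>r\<in>A - {s}. [:-r, 1:])"
  have coeffs: "(of_rat (coeff (q n) i) :: complex) = (\<Sum>s\<in>A. qeval h s ^ n / poly (l s) s * coeff (l s) i)" for n i
  proof -
    have "degree (map_poly of_rat (q n) :: complex poly) < card A"
      using q(1) card by (simp add: degree_map_poly)
    from lagrange_interpolation[OF finA this]
    have "map_poly of_rat (q n) = (\<Sum>s\<in>A. smult (qeval h s ^ n / poly (l s) s) (l s))"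
      using qs unfolding l_def by (simp add: qeval_def)
    then have "coeff (map_poly of_rat (q n)) i = coeff (\<Sum>s\<in>A. smult (qeval h s ^ n / poly (l s) s) (l s)) i" by simp
    then show ?thesis by (simp add: coeff_map_poly coeff_sum)
  qed
  have lim: "(\<lambda>n. of_rat (coeff (q n) i) :: complex) \<longlonglongrightarrow> 0" for i
    unfolding coeffs
  proof (rule tendsto_null_sum)
    fix s assume "s \<in> A"
    then have "(\<lambda>n. qeval h s ^ n) \<longlonglongrightarrow> 0"
      using small conjA by (intro LIMSEQ_power_zero) blast
    then have "(\<lambda>n. qeval h s ^ n * (coeff (l s) i / poly (l s) s)) \<longlonglongrightarrow> 0"
      by (rule tendsto_mult_left_zero)
    then show "(\<lambda>n. qeval h s ^ n / poly (l s) s * coeff (l s) i) \<longlonglongrightarrow> 0"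
      by (simp add: mult_ac)
  qed
  have "eventually (\<lambda>n. coeff (q n) i = 0) sequentially" for i
  proof -
    have "eventually (\<lambda>n. norm (of_rat (coeff (q n) i) :: complex) < 1 / of_int L) sequentially"
      using lim[of i] L(1) by (auto simp: tendsto_iff dist_norm)
    then show ?thesis
    proof eventually_elim
      case (elim n)
      obtain k where k: "of_int L * coeff (q n) i = of_int k" using q(2) by (blast elim: Ints_cases)
      have "norm (of_rat (of_int L * coeff (q n) i) :: complex) = of_int L * norm (of_rat (coeff (q n) i) :: complex)"
        using L(1) by (simp add: of_rat_mult norm_mult)
      also have "\<dots> < 1" using elim L(1) by (simp add: field_simps)
      finally have "\<bar>k\<bar> < 1" unfolding k by (simp flip: of_int_abs)
      then show ?case using k L(1) by simp
    qed
  qed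
  then have "eventually (\<lambda>n. \<forall>i\<in>{..<degree m}. coeff (q n) i = 0) sequentially"
    by (simp add: eventually_ball_finite_distrib)
  then obtain n where n: "\<And>i. i < degree m \<Longrightarrow> coeff (q n) i = 0"
    unfolding eventually_sequentially by blast
  have "coeff (q n) i = 0" for i
  proof (cases "i < degree m")
    case False
    then have "degree (q n) < i" using q(1)[of n] by linarith
    then show ?thesis by (rule coeff_eq_0)
  qed (rule n)
  then have "q n = 0" by (intro poly_eqI) simp
  then have "qeval h x ^ n = 0" using q(3)[of n] by simp
  then show ?thesis by simp
qed

section \<open>Integral ternary forms\<close>

text \<open>
  The group generated by this set consists of the values at (1, x, y) of all ternary forms of
  degree d with integer coefficients: the first coordinate takes up the missing degree.
\<close>

definition monomials :: "complex \<Rightarrow> complex \<Rightarrow> nat \<Rightarrow> complex set" where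
  "monomials x y d = (\<lambda>(i, j). x ^ i * y ^ j) ` {(i, j). i + j \<le> d}"

lemma monomialsI: "i + j \<le> d \<Longrightarrow> x ^ i * y ^ j \<in> monomials x y d"
  unfolding monomials_def by force

lemma zspan_monomials_mult:
  assumes "s \<in> zspan (monomials x y d)" "t \<in> zspan (monomials x y d')"
  shows "s * t \<in> zspan (monomials x y (d + d'))"
proof (rule zspan_mult_left[OF _ assms(2)])
  fix b assume "b \<in> monomials x y d'"
  then obtain i j where b: "b = x ^ i * y ^ j" "i + j \<le> d'" unfolding monomials_def by auto
  have "b * s \<in> zspan (monomials x y (d + d'))"
  proof (rule zspan_mult_left[OF _ assms(1)])
    fix c assume "c \<in> monomials x y d"
    then obtain i' j' where c: "c = x ^ i' * y ^ j'" "i' + j' \<le> d" unfolding monomials_def by auto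
    have "b * c = x ^ (i + i') * y ^ (j + j')" using b c by (simp add: power_add mult_ac)
    then show "b * c \<in> zspan (monomials x y (d + d'))"
      using b c zspan_base monomialsI[of "i + i'" "j + j'" "d + d'" x y] by simp
  qed
  then show "s * b \<in> zspan (monomials x y (d + d'))" by (simp add: mult.commute)
qed

text \<open>
  A number G whose multiples by 1^k, x^k, y^k are all integral forms of degree dG = k - e acts as
  an integral form of degree -e: a monomial of degree d \<ge> 3 k in the coordinates 1, x, y is
  divisible by the k-th power of one of them.
\<close>

lemma zspan_shift:
  assumes G: "G \<in> zspan (monomials x y dG)" "G * x ^ k \<in> zspan (monomials x y dG)" "G * y ^ k \<in> zspan (monomials x y dG)"
    and "dG + e = k" "3 * k \<le> d" and s: "s \<in> zspan (monomials x y d)"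
  shows "G * s \<in> zspan (monomials x y (d - e))"
proof (rule zspan_mult_left[OF _ s])
  fix b assume "b \<in> monomials x y d"
  then obtain i j where b: "b = x ^ i * y ^ j" "i + j \<le> d" unfolding monomials_def by auto
  have de: "dG + (d - k) = d - e" using assms(4,5) by linarith
  have m: "H * (x ^ i' * y ^ j') \<in> zspan (monomials x y (d - e))"
    if "H \<in> zspan (monomials x y dG)" "i' + j' \<le> d - k" for H i' j'
    using zspan_monomials_mult[OF that(1) zspan_base[OF monomialsI[OF that(2)]]] unfolding de .
  consider "k \<le> i" | "k \<le> j" | "i + j \<le> d - k" using assms(5) by linarith
  then show "G * b \<in> zspan (monomials x y (d - e))"
  proof cases
    case 1
    then have "x ^ i = x ^ k * x ^ (i - k)" by (simp flip: power_add)
    then have "G * b = G * x ^ k * (x ^ (i - k) * y ^ j)" unfolding b by (simp only: mult_ac)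
    moreover have "i - k + j \<le> d - k" using b(2) 1 by linarith
    ultimately show ?thesis using m[OF G(2)] by metis
  next
    case 2
    then have "y ^ j = y ^ k * y ^ (j - k)" by (simp flip: power_add)
    then have "G * b = G * y ^ k * (x ^ i * y ^ (j - k))" unfolding b by (simp only: mult_ac)
    moreover have "i + (j - k) \<le> d - k" using b(2) 2 by linarith
    ultimately show ?thesis using m[OF G(3)] by metis
  next
    case 3
    then show ?thesis using m[OF G(1), of i j] b by simp
  qed
qed

text \<open>
  Ternary forms of degree d with integer coefficients, the sum of whose absolute values is at most
  C. Keeping track of C along the construction of a form yields all size estimates at once.
\<close>

inductive int_form :: "nat \<Rightarrow> real \<Rightarrow> (complex \<Rightarrow> complex \<Rightarrow> complex \<Rightarrow> complex) \<Rightarrow> bool" where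
  zero: "int_form d 0 (\<lambda>u v w. 0)"
| const: "int_form 0 \<bar>real_of_int k\<bar> (\<lambda>u v w. of_int k)"
| fst: "int_form 1 1 (\<lambda>u v w. u)"
| snd: "int_form 1 1 (\<lambda>u v w. v)"
| thd: "int_form 1 1 (\<lambda>u v w. w)"
| add: "int_form d C F \<Longrightarrow> int_form d C' G \<Longrightarrow> int_form d (C + C') (\<lambda>u v w. F u v w + G u v w)"
| mult: "int_form d C F \<Longrightarrow> int_form d' C' G \<Longrightarrow> int_form (d + d') (C * C') (\<lambda>u v w. F u v w * G u v w)"
| weaken: "int_form d C F \<Longrightarrow> C \<le> C' \<Longrightarrow> int_form d C' F"

lemma int_form_scale: "int_form d C F \<Longrightarrow> int_form d (\<bar>real_of_int k\<bar> * C) (\<lambda>u v w. of_int k * F u v w)"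
  using int_form.mult[OF int_form.const[of k]] by fastforce

lemma int_form_diff:
  assumes "int_form d C F" "int_form d C' G"
  shows "int_form d (C + C') (\<lambda>u v w. F u v w - G u v w)"
  using int_form.add[OF assms(1) int_form_scale[OF assms(2), of "-1"]] by simp

lemma int_form_power: "int_form d C F \<Longrightarrow> int_form (n * d) (C ^ n) (\<lambda>u v w. F u v w ^ n)"
proof (induction n)
  case 0
  show ?case using int_form.const[of 1] by simp
next
  case (Suc n)
  then show ?case using int_form.mult[of d C F "n * d" "C ^ n"] by simp
qed

lemma int_form_sum:
  "finite I \<Longrightarrow> (\<And>i. i \<in> I \<Longrightarrow> int_form d (C i) (F i)) \<Longrightarrow>
     int_form d (\<Sum>i\<in>I. C i) (\<lambda>u v w. \<Sum>i\<in>I. F i u v w)"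
  by (induction I rule: finite_induct) (auto intro: int_form.zero int_form.add)

lemma int_form_bound:
  assumes "int_form d C F" "norm u \<le> R" "norm v \<le> R" "norm w \<le> R"
  shows "C \<ge> 0 \<and> norm (F u v w) \<le> C * R ^ d"
  using assms(1)
proof (induction rule: int_form.induct)
  case (add d C F C' G)
  then show ?case using norm_triangle_ineq[of "F u v w" "G u v w"] by (simp add: algebra_simps)
next
  case (mult d C F d' C' G)
  have "R \<ge> 0" using assms(2) norm_ge_zero order_trans by blast
  then have "norm (F u v w) * norm (G u v w) \<le> (C * R ^ d) * (C' * R ^ d')"
    using mult.IH by (intro mult_mono) auto
  then show ?case using mult.IH by (simp add: norm_mult power_add mult_ac)
next
  case (weaken d C F C')
  have "R \<ge> 0" using assms(2) norm_ge_zero order_trans by blast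
  then have "C * R ^ d \<le> C' * R ^ d" using weaken by (intro mult_right_mono) auto
  then show ?case using weaken by linarith
qed (use assms in auto)

lemma int_form_zspan:
  "int_form d C F \<Longrightarrow> F 1 x y \<in> zspan (monomials x y d)"
proof (induction rule: int_form.induct)
  case (const k)
  show ?case using zspan_scale[OF zspan_base[OF monomialsI[of 0 0 0 x y]], of k] by simp
next
  case fst
  show ?case using zspan_base[OF monomialsI[of 0 0 1 x y]] by simp
next
  case snd
  show ?case using zspan_base[OF monomialsI[of 1 0 1 x y]] by simp
next
  case thd
  show ?case using zspan_base[OF monomialsI[of 0 1 1 x y]] by simp
qed (auto intro: zspan.zero zspan_add zspan_monomials_mult)

lemma int_form_qeval: "int_form d C F \<Longrightarrow> \<exists>h. \<forall>s. F 1 s (qeval g s) = qeval h s"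
proof (induction rule: int_form.induct)
  case (zero d)
  show ?case by (rule exI[of _ 0]) simp
next
  case (const k)
  show ?case by (rule exI[of _ "[:of_int k:]"]) simp
next
  case fst
  show ?case by (rule exI[of _ 1]) simp
next
  case snd
  show ?case by (rule exI[of _ "[:0, 1:]"]) simp
next
  case thd
  show ?case by blast
next
  case (add d C F C' G)
  then show ?case by (metis qeval_add)
next
  case (mult d C F d' C' G)
  then show ?case by (metis qeval_mult)
qed


section \<open>An absolute bound on the line U + V + W = 0\<close>

text \<open>
  This is the Schur-Cohn inequality for the quadratic polynomial with roots p and q in the closed
  unit disc. Because p + q = 1 is real, 1 - p q equals (p + q) - p q cnj (p + q) = p (1 - |q|^2) +
  q (1 - |p|^2), which is estimated by the triangle inequality.
\<close>

lemma norm_one_minus_mult_le: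
  fixes p q :: complex
  assumes "p + q = 1" "norm p \<le> 1" "norm q \<le> 1"
  shows "norm (1 - p * q) \<le> 1 - norm (p * q) ^ 2"
proof -
  have c: "p * cnj p = of_real (norm p ^ 2)" "q * cnj q = of_real (norm q ^ 2)"
    by (simp_all only: complex_norm_square)
  have "1 - p * q = (p + q) - p * q * cnj (p + q)" unfolding assms(1) by simp
  also have "\<dots> = p * (1 - q * cnj q) + q * (1 - p * cnj p)" by (simp add: algebra_simps)
  also have "\<dots> = p * of_real (1 - norm q ^ 2) + q * of_real (1 - norm p ^ 2)" unfolding c by simp
  finally have "norm (1 - p * q) \<le> norm (p * of_real (1 - norm q ^ 2)) + norm (q * of_real (1 - norm p ^ 2))"
    using norm_triangle_ineq by metis
  also have "\<dots> = norm p * (1 - norm q ^ 2) + norm q * (1 - norm p ^ 2)"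
    using power_le_one[OF norm_ge_zero assms(2), of 2] power_le_one[OF norm_ge_zero assms(3), of 2]
    by (simp add: norm_mult del: of_real_diff)
  also have "\<dots> = (norm p + norm q) * (1 - norm p * norm q)" by (simp add: algebra_simps power2_eq_square)
  also have "\<dots> \<le> (1 + norm p * norm q) * (1 - norm p * norm q)"
  proof (rule mult_right_mono)
    have "0 \<le> (1 - norm p) * (1 - norm q)" using assms by simp
    then show "norm p + norm q \<le> 1 + norm p * norm q" by (simp add: algebra_simps)
    show "0 \<le> 1 - norm p * norm q" using assms by (simp add: mult_le_one)
  qed
  also have "\<dots> = 1 - norm (p * q) ^ 2" by (simp add: norm_mult algebra_simps power2_eq_square)
  finally show ?thesis .
qed

text \<open>
  After scaling w to -1, the left-hand side becomes |1 - p q| r^2 \<le> (1 - r^2) r^2 \<le> 1/4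
  with r = |p q|.
\<close>

lemma e2_e3_bound_ordered:
  fixes u v w :: complex
  assumes "u + v + w = 0" "norm u \<le> norm w" "norm v \<le> norm w"
  shows "norm (u * v + v * w + w * u) * norm (u * v * w) ^ 2 \<le> norm w ^ 8 / 4"
proof (cases "w = 0")
  case False
  define p q where "p = - u / w" and "q = - v / w"
  have uv: "u = - (p * w)" "v = - (q * w)" using False by (auto simp: p_def q_def)
  have "p + q = - (u + v) / w" by (simp add: p_def q_def add_divide_distrib diff_divide_distrib)
  also have "- (u + v) = w" using assms(1) by (simp add: algebra_simps add_eq_0_iff)
  finally have pq: "p + q = 1" using False by simp
  have n: "norm p \<le> 1" "norm q \<le> 1" using assms False by (auto simp: p_def q_def norm_divide)
  have "u * v + v * w + w * u = w ^ 2 * (p * q - (p + q))" unfolding uv by (simp add: algebra_simps power2_eq_square)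
  then have e2: "norm (u * v + v * w + w * u) = norm w ^ 2 * norm (1 - p * q)"
    unfolding pq by (simp add: norm_mult norm_power norm_minus_commute)
  have e3: "norm (u * v * w) = norm w ^ 3 * norm (p * q)"
    unfolding uv by (simp add: norm_mult power3_eq_cube mult_ac)
  have "norm (1 - p * q) * norm (p * q) ^ 2 \<le> (1 - norm (p * q) ^ 2) * norm (p * q) ^ 2"
    by (rule mult_right_mono[OF norm_one_minus_mult_le[OF pq n]]) simp
  also have "\<dots> \<le> 1 / 4"
    using sum_squares_ge_zero[of "1 / 2 - norm (p * q) ^ 2" 0] by (simp add: algebra_simps power2_eq_square)
  finally have "norm w ^ 8 * (norm (1 - p * q) * norm (p * q) ^ 2) \<le> norm w ^ 8 * (1 / 4)"
    by (intro mult_left_mono) auto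
  moreover have "norm w ^ 8 * (norm (1 - p * q) * norm (p * q) ^ 2) = norm (u * v + v * w + w * u) * norm (u * v * w) ^ 2"
    unfolding e2 e3 by (simp add: power_mult_distrib algebra_simps flip: power_mult power_add)
  ultimately show ?thesis by simp
qed simp

lemma e2_e3_bound:
  fixes u v w :: complex
  assumes "u + v + w = 0" "norm u \<le> R" "norm v \<le> R" "norm w \<le> R"
  shows "norm (u * v + v * w + w * u) * norm (u * v * w) ^ 2 \<le> R ^ 8 / 4"
proof -
  have mono: "norm z ^ 8 / 4 \<le> R ^ 8 / 4" if "norm z \<le> R" for z :: complex
    using power_mono[OF that, of 8] by simp
  consider "norm u \<le> norm w" "norm v \<le> norm w" | "norm u \<le> norm v" "norm w \<le> norm v"
    | "norm v \<le> norm u" "norm w \<le> norm u" by linarith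
  then show ?thesis
  proof cases
    case 1
    then show ?thesis using e2_e3_bound_ordered[OF assms(1)] mono[OF assms(4)] by simp
  next
    case 2
    have "w + u + v = 0" using assms(1) by (simp add: add_ac)
    from e2_e3_bound_ordered[OF this 2(2,1)] show ?thesis using mono[OF assms(3)] by (simp add: mult_ac add_ac)
  next
    case 3
    have "v + w + u = 0" using assms(1) by (simp add: add_ac)
    from e2_e3_bound_ordered[OF this 3(1,2)] show ?thesis using mono[OF assms(2)] by (simp add: mult_ac add_ac)
  qed
qed


section \<open>No small form of degree zero\<close>

text \<open>
  The form G1, evaluated at (1, x, y), is the number theta of degree -e: by the relations, its
  multiples by x^k and y^k are forms of degree dG = k - e too. Multiplying theta^(8a) with the
  e-th power of the form F = E P^2, where E and P are the elementary symmetric functions of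
  degrees 2 and 3 in the a-th powers, gives a number of degree 0. Its powers stay in the group of
  integral forms of one fixed degree, and its conjugates are bounded by C^(8a) / 4^e.
\<close>

lemma no_small_form:
  fixes x y :: complex
  assumes alg: "F0 \<noteq> 0" "qeval F0 x = 0" and y: "y = qeval g x"
    and sol: "1 + x ^ a + y ^ a = 0" and nz: "x \<noteq> 0" "y \<noteq> 0" "x ^ a + x ^ a * y ^ a + y ^ a \<noteq> 0"
    and G: "int_form dG C G1" "int_form dG C G2" "int_form dG C G3" and k: "dG + e = k"
    and rel: "\<And>s. conjugate x s \<Longrightarrow> G1 1 s (qeval g s) * s ^ k = G2 1 s (qeval g s) \<and>
        G1 1 s (qeval g s) * qeval g s ^ k = G3 1 s (qeval g s)"
    and G0: "G1 1 x y \<noteq> 0" and C: "C ^ (8 * a) < 4 ^ e"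
  shows False
proof -
  define E where "E = (\<lambda>u v w :: complex. u ^ a * v ^ a + v ^ a * w ^ a + w ^ a * u ^ a)"
  define P where "P = (\<lambda>u v w :: complex. u ^ a * v ^ a * w ^ a)"
  define F where "F = (\<lambda>u v w. E u v w * P u v w ^ 2)"
  define H where "H = (\<lambda>u v w. G1 u v w ^ (8 * a) * F u v w ^ e)"
  note pows = int_form_power[OF int_form.fst, of a] int_form_power[OF int_form.snd, of a] int_form_power[OF int_form.thd, of a]
  have "\<exists>C. int_form (8 * a) C F"
  proof -
    have "int_form (a + a) 3 E"
      using int_form.add[OF int_form.add[OF int_form.mult[OF pows(1,2)] int_form.mult[OF pows(2,3)]] int_form.mult[OF pows(3,1)]]
      unfolding E_def by simp
    moreover have "int_form (2 * (a + a + a)) 1 (\<lambda>u v w. P u v w ^ 2)"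
      using int_form_power[OF int_form.mult[OF int_form.mult[OF pows(1,2)] pows(3)], of 2] unfolding P_def by simp
    ultimately have "int_form ((a + a) + 2 * (a + a + a)) (3 * 1) F"
      unfolding F_def by (rule int_form.mult)
    moreover have "(a + a) + 2 * (a + a + a) = 8 * a" by simp
    ultimately show ?thesis by metis
  qed
  then obtain CF where F: "int_form (8 * a) CF F" by blast
  have "int_form (8 * a * dG + e * (8 * a)) (C ^ (8 * a) * CF ^ e) H"
    unfolding H_def by (rule int_form.mult[OF int_form_power[OF G(1)] int_form_power[OF F]])
  from int_form_qeval[OF this, of g] obtain h where h: "\<And>s. H 1 s (qeval g s) = qeval h s" by blast
  have hx: "qeval h x = H 1 x y" unfolding h[symmetric] y ..
  have "H 1 x y \<noteq> 0"
    using G0 nz unfolding H_def F_def E_def P_def by (simp add: add_ac)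
  moreover have "qeval h x = 0"
  proof (rule small_conjugates_imp_zero[OF alg])
    \<comment> \<open>The 8 a multiplications by theta lower the degree from d to 3 k; the factor F^e of degree 8 a e restores it.\<close>
    define d where "d = 3 * k + 8 * a * e"
    define B :: "rat poly set" where "B = (\<lambda>(i, j). [:0, 1:] ^ i * g ^ j) ` ({..d} \<times> {..d})"
    show "finite B" unfolding B_def by simp
    have conjx: "conjugate x x" unfolding conjugate_def by simp
    note relx = rel[OF conjx, folded y]
    note Gz = int_form_zspan[OF G(1), of x y] int_form_zspan[OF G(2), of x y] int_form_zspan[OF G(3), of x y]
    have Gpow: "G1 1 x y ^ m * s \<in> zspan (monomials x y (d - m * e))"
      if "s \<in> zspan (monomials x y d)" "m \<le> 8 * a" for m s
      using that(2)
    proof (induction m)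
      case 0
      then show ?case using that(1) by simp
    next
      case (Suc m)
      have "Suc m * e \<le> 8 * a * e" using Suc.prems by (rule mult_le_mono1)
      then have le: "3 * k \<le> d - m * e" unfolding d_def by simp
      have "G1 1 x y * (G1 1 x y ^ m * s) \<in> zspan (monomials x y (d - m * e - e))"
        by (rule zspan_shift[OF Gz(1) _ _ k le]) (use relx Gz Suc in auto)
      moreover have "d - m * e - e = d - Suc m * e" by simp
      ultimately show ?case by (simp add: mult_ac)
    qed
    have stab: "qeval h x * s \<in> zspan (monomials x y d)" if "s \<in> zspan (monomials x y d)" for s
    proof -
      have "F 1 x y ^ e * (G1 1 x y ^ (8 * a) * s) \<in> zspan (monomials x y (e * (8 * a) + (d - 8 * a * e)))"
        by (rule zspan_monomials_mult[OF int_form_zspan[OF int_form_power[OF F]] Gpow[OF that order_refl]])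
      moreover have "e * (8 * a) + (d - 8 * a * e) = d" unfolding d_def by simp
      ultimately show ?thesis unfolding hx H_def by (simp add: mult_ac)
    qed
    have "qeval h x ^ n \<in> zspan (monomials x y d)" for n
    proof (induction n)
      case 0
      show ?case using zspan_base[OF monomialsI[of 0 0 d x y]] by simp
    qed (use stab in simp)
    moreover have "zspan (monomials x y d) \<subseteq> zspan ((\<lambda>w. qeval w x) ` B)"
    proof
      fix s assume s: "s \<in> zspan (monomials x y d)"
      have "1 * s \<in> zspan ((\<lambda>w. qeval w x) ` B)"
      proof (rule zspan_mult_left[OF _ s])
        fix b assume "b \<in> monomials x y d"
        then obtain i j where b: "b = x ^ i * y ^ j" "i + j \<le> d" unfolding monomials_def by auto
        then have "b = qeval ([:0, 1:] ^ i * g ^ j) x" unfolding y by simp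
        moreover have "[:0, 1:] ^ i * g ^ j \<in> B" unfolding B_def using b by force
        ultimately have "b \<in> (\<lambda>w. qeval w x) ` B" by (rule image_eqI)
        then show "1 * b \<in> zspan ((\<lambda>w. qeval w x) ` B)" by (simp add: zspan_base)
      qed
      then show "s \<in> zspan ((\<lambda>w. qeval w x) ` B)" by simp
    qed
    ultimately show "qeval h x ^ n \<in> zspan ((\<lambda>w. qeval w x) ` B)" for n by blast
    fix s assume cs: "conjugate x s"
    define t where "t = qeval g s"
    have "qeval (1 + [:0, 1:] ^ a + g ^ a) x = 0" using sol y by simp
    then have "qeval (1 + [:0, 1:] ^ a + g ^ a) s = 0" using cs unfolding conjugate_def by blast
    then have sol': "1 + s ^ a + t ^ a = 0" by (simp add: t_def)
    define R where "R = max 1 (max (norm s) (norm t))"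
    have R: "norm (1::complex) \<le> R" "norm s \<le> R" "norm t \<le> R" "R \<ge> 1" by (auto simp: R_def)
    have bd: "norm (G 1 s t) \<le> C * R ^ dG" if "int_form dG C G" for G
      using int_form_bound[OF that R(1-3)] by blast
    have C0: "C \<ge> 0" using int_form_bound[OF G(1) R(1-3)] by blast
    \<comment> \<open>The relation that belongs to the largest of the coordinates 1, s, t gives the bound.\<close>
    have "norm (G1 1 s t) * R ^ k \<le> C * R ^ dG"
    proof -
      consider "R = 1" | "R = norm s" | "R = norm t" unfolding R_def by linarith
      then show ?thesis
      proof cases
        case 1
        then show ?thesis using bd[OF G(1)] by simp
      next
        case 2
        then have "norm (G1 1 s t) * R ^ k = norm (G2 1 s t)"
          using rel[OF cs] by (simp add: t_def flip: norm_power norm_mult)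
        then show ?thesis using bd[OF G(2)] by simp
      next
        case 3
        then have "norm (G1 1 s t) * R ^ k = norm (G3 1 s t)"
          using rel[OF cs] by (simp add: t_def flip: norm_power norm_mult)
        then show ?thesis using bd[OF G(3)] by simp
      qed
    qed
    then have "(norm (G1 1 s t) * R ^ e) * R ^ dG \<le> C * R ^ dG"
      unfolding k[symmetric] by (simp add: power_add mult_ac)
    then have th: "norm (G1 1 s t) * R ^ e \<le> C"
      using R(4) by (simp add: mult_le_cancel_right)
    have pw: "norm (1::complex) \<le> R ^ a" "norm (s ^ a) \<le> R ^ a" "norm (t ^ a) \<le> R ^ a"
      using R by (auto simp: norm_power intro: power_mono one_le_power)
    have "norm (F 1 s t) \<le> (R ^ a) ^ 8 / 4"
      using e2_e3_bound[OF sol' pw] unfolding F_def E_def P_def by (simp add: norm_mult norm_power)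
    then have Fb: "norm (F 1 s t) ^ e \<le> ((R ^ a) ^ 8 / 4) ^ e" by (rule power_mono) simp
    have "norm (qeval h s) = norm (G1 1 s t) ^ (8 * a) * norm (F 1 s t) ^ e"
      unfolding h[symmetric] H_def t_def by (simp add: norm_mult norm_power)
    also have "\<dots> \<le> norm (G1 1 s t) ^ (8 * a) * ((R ^ a) ^ 8 / 4) ^ e"
      using Fb by (intro mult_left_mono) auto
    also have "\<dots> = (norm (G1 1 s t) * R ^ e) ^ (8 * a) / 4 ^ e"
      by (simp add: power_mult_distrib power_divide mult_ac flip: power_mult)
    also have "\<dots> \<le> C ^ (8 * a) / 4 ^ e"
      using th R by (intro divide_right_mono power_mono) auto
    also have "\<dots> < 1" using C by simp
    finally show "norm (qeval h s) < 1" .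
  qed
  ultimately show False using hx by simp
qed

section \<open>Pade forms as integral forms\<close>

text \<open>
  Both binomial factors are at most powers of 2 with exponent p + q + r + 1. Only an exponential
  bound matters, because the exponents enter the final comparison with a large constant to spare.
\<close>

lemma pade_poly_coefficient_sum: "(\<Sum>j\<le>r. real ((p + q + r + 1) choose (r - j)) * real ((q + j) choose j)) \<le> 4 ^ (p + q + r + 1)"
proof -
  have "(\<Sum>j\<le>r. ((p + q + r + 1) choose (r - j)) * ((q + j) choose j)) \<le> (\<Sum>j\<le>r. ((p + q + r + 1) choose (r - j)) * 2 ^ (p + q + r + 1))"
  proof (intro sum_mono mult_le_mono2)
    fix j assume "j \<in> {..r}"
    have "(q + j) choose j \<le> 2 ^ (q + j)" by (rule binomial_le_pow2)
    also have "\<dots> \<le> 2 ^ (p + q + r + 1)" using \<open>j \<in> {..r}\<close> by (intro power_increasing) auto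
    finally show "(q + j) choose j \<le> 2 ^ (p + q + r + 1)" .
  qed
  also have "\<dots> = (\<Sum>j\<le>r. (p + q + r + 1) choose j) * 2 ^ (p + q + r + 1)"
    unfolding sum_distrib_right
    by (rule sum.reindex_bij_witness[of _ "\<lambda>j. r - j" "\<lambda>j. r - j"]) auto
  also have "(\<Sum>j\<le>r. (p + q + r + 1) choose j) \<le> (\<Sum>j\<le>p + q + r + 1. (p + q + r + 1) choose j)"
    by (intro sum_mono2) auto
  also have "\<dots> = 2 ^ (p + q + r + 1)" by (rule choose_row_sum)
  finally have "(\<Sum>j\<le>r. ((p + q + r + 1) choose (r - j)) * ((q + j) choose j)) \<le> 2 ^ (p + q + r + 1) * 2 ^ (p + q + r + 1)"
    by simp
  also have "\<dots> = (4::nat) ^ (p + q + r + 1)" by (subst power_mult_distrib[symmetric]) simp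
  finally have "real (\<Sum>j\<le>r. ((p + q + r + 1) choose (r - j)) * ((q + j) choose j)) \<le> real (4 ^ (p + q + r + 1))"
    by (simp only: of_nat_le_iff)
  then show ?thesis by simp
qed

lemma int_form_pade_poly:
  assumes F: "int_form d 1 F" and G: "int_form d 1 G"
  shows "int_form (r * d) (4 ^ (p + q + r + 1)) (\<lambda>u v w. pade_poly p q r (F u v w) (G u v w))"
proof (rule int_form.weaken[OF _ pade_poly_coefficient_sum])
  have "int_form (r * d) (\<Sum>j\<le>r. real ((p + q + r + 1) choose (r - j)) * real ((q + j) choose j))
     (\<lambda>u v w. \<Sum>j\<le>r. of_nat ((p + q + r + 1) choose (r - j)) * of_nat ((q + j) choose j) * F u v w ^ (r - j) * G u v w ^ j)"
  proof (rule int_form_sum)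
    fix j assume "j \<in> {..r}"
    then have deg: "(r - j) * d + j * d = r * d" by (simp flip: add_mult_distrib)
    have "int_form (r * d) (1 ^ (r - j) * 1 ^ j) (\<lambda>u v w. F u v w ^ (r - j) * G u v w ^ j)"
      using int_form.mult[OF int_form_power[OF F, of "r - j"] int_form_power[OF G, of j]] unfolding deg .
    from int_form_scale[OF this, of "int (((p + q + r + 1) choose (r - j)) * ((q + j) choose j))"]
    show "int_form (r * d) (real ((p + q + r + 1) choose (r - j)) * real ((q + j) choose j))
     (\<lambda>u v w. of_nat ((p + q + r + 1) choose (r - j)) * of_nat ((q + j) choose j) * F u v w ^ (r - j) * G u v w ^ j)"
      by (simp add: mult.assoc abs_mult del: binomial_Suc_Suc)
  qed simp
  then show "int_form (r * d) (\<Sum>j\<le>r. real ((p + q + r + 1) choose (r - j)) * real ((q + j) choose j))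
     (\<lambda>u v w. pade_poly p q r (F u v w) (G u v w))" unfolding pade_poly_def .
qed

text \<open>
  The Pade component with arguments u^b and v^b, divided by v^k.
\<close>

definition cofactor :: "nat \<Rightarrow> nat \<Rightarrow> nat \<Rightarrow> nat \<Rightarrow> nat \<Rightarrow> complex \<Rightarrow> complex \<Rightarrow> complex" where
  "cofactor b k p q r u v = (-1) ^ (p + 1) * v ^ ((p + q + 1) * b - k) * pade_poly p q r (u ^ b) (v ^ b)"

lemma cofactor_mult:
  assumes "k \<le> (p + q + 1) * b"
  shows "v ^ k * cofactor b k p q r u v = pade_term p q r (u ^ b) (v ^ b)"
proof -
  have "v ^ k * v ^ ((p + q + 1) * b - k) = (v ^ b) ^ (p + q + 1)"
    using assms by (simp only: power_add[symmetric] power_mult[symmetric]) (simp add: mult.commute)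
  then show ?thesis unfolding cofactor_def pade_term_def by (simp add: mult_ac)
qed

lemma int_form_cofactor:
  assumes F: "int_form 1 1 F" and G: "int_form 1 1 G" and k: "k \<le> (p + q + 1) * b"
  shows "int_form ((p + q + r + 1) * b - k) (4 ^ (p + q + r + 1)) (\<lambda>u v w. cofactor b k p q r (F u v w) (G u v w))"
proof -
  have Fb: "int_form b 1 (\<lambda>u v w. F u v w ^ b)" and Gb: "int_form b 1 (\<lambda>u v w. G u v w ^ b)"
    using int_form_power[OF F, of b] int_form_power[OF G, of b] by simp_all
  have "int_form ((p + q + 1) * b - k + r * b) (1 * 4 ^ (p + q + r + 1))
     (\<lambda>u v w. G u v w ^ ((p + q + 1) * b - k) * pade_poly p q r (F u v w ^ b) (G u v w ^ b))"
    using int_form.mult[OF int_form_power[OF G, of "(p + q + 1) * b - k"] int_form_pade_poly[OF Fb Gb, of r p q]] by simp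
  from int_form_scale[OF this, of "(-1) ^ (p + 1)"]
  have "int_form ((p + q + 1) * b - k + r * b) (4 ^ (p + q + r + 1))
     (\<lambda>u v w. (-1) ^ (p + 1) * (G u v w ^ ((p + q + 1) * b - k) * pade_poly p q r (F u v w ^ b) (G u v w ^ b)))"
    by (simp add: abs_mult)
  moreover have "(p + q + 1) * b - k + r * b = (p + q + r + 1) * b - k" using k by (simp add: algebra_simps)
  ultimately show ?thesis unfolding cofactor_def by (simp add: mult.assoc)
qed


section \<open>Two large exponents\<close>

text \<open>
  The vectors (A1, x^k A2, y^k A3) and (B1, x^k B2, y^k B3) are both orthogonal to (1, 1, 1), so
  the three coordinates of their cross product coincide. Cancelling (x y)^k turns this into the
  relations that make A2 B3 - A3 B2 a number of degree -e in the sense of the lemma no_small_form.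
  It must therefore vanish, and the two vectors are proportional.
\<close>

lemma cross_product_forms:
  fixes x y :: complex
  assumes alg: "F0 \<noteq> 0" "qeval F0 x = 0" and y: "y = qeval g x"
    and sol: "1 + x ^ a + y ^ a = 0" and nz: "x \<noteq> 0" "y \<noteq> 0" "x ^ a + x ^ a * y ^ a + y ^ a \<noteq> 0"
    and A: "int_form dA CA A1" "int_form dA CA A2" "int_form dA CA A3"
    and B: "int_form dB 1 B1" "int_form dB 1 B2" "int_form dB 1 B3"
    and k: "dA + dB + e = k"
    and rel: "\<And>s. conjugate x s \<Longrightarrow>
       A1 1 s (qeval g s) + s ^ k * A2 1 s (qeval g s) + qeval g s ^ k * A3 1 s (qeval g s) = 0"
       "\<And>s. conjugate x s \<Longrightarrow>
       B1 1 s (qeval g s) + s ^ k * B2 1 s (qeval g s) + qeval g s ^ k * B3 1 s (qeval g s) = 0"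
    and C: "(2 * CA) ^ (8 * a) < 4 ^ e"
  shows "A3 1 x y * B1 1 x y = A1 1 x y * B3 1 x y \<and> A2 1 x y * B3 1 x y = A3 1 x y * B2 1 x y"
proof -
  define G where "G = (\<lambda>(A2 :: complex \<Rightarrow> complex \<Rightarrow> complex \<Rightarrow> complex) A3 B2 B3 u v w. A2 u v w * B3 u v w - A3 u v w * B2 u v w)"
  have form: "int_form (dA + dB) (2 * CA) (G A A' B B')"
    if "int_form dA CA A" "int_form dA CA A'" "int_form dB 1 B" "int_form dB 1 B'" for A A' B B'
    using int_form_diff[OF int_form.mult[OF that(1,4)] int_form.mult[OF that(2,3)]] unfolding G_def by simp
  have eqs: "G A2 A3 B2 B3 1 s (qeval g s) * s ^ k = G A3 A1 B3 B1 1 s (qeval g s) \<and>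
        G A2 A3 B2 B3 1 s (qeval g s) * qeval g s ^ k = G A1 A2 B1 B2 1 s (qeval g s)"
    if s: "conjugate x s" for s
  proof -
    define t where "t = qeval g s"
    note r = rel(1)[OF s, folded t_def] rel(2)[OF s, folded t_def]
    have 1: "A1 1 s t = - (s ^ k * A2 1 s t + t ^ k * A3 1 s t)" "B1 1 s t = - (s ^ k * B2 1 s t + t ^ k * B3 1 s t)"
      using r by (simp_all only: add.assoc eq_neg_iff_add_eq_0)
    show ?thesis unfolding t_def[symmetric] G_def 1 by (simp add: algebra_simps)
  qed
  have "G A2 A3 B2 B3 1 x y = 0"
    using no_small_form[OF alg y sol nz form[OF A(2,3) B(2,3)] form[OF A(3,1) B(3,1)] form[OF A(1,2) B(1,2)] k eqs _ C]
    by blast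
  moreover have "conjugate x x" unfolding conjugate_def by simp
  ultimately have "G A2 A3 B2 B3 1 x y = 0" "G A3 A1 B3 B1 1 x y = 0" using eqs[of x] unfolding y by auto
  then show ?thesis unfolding G_def by (simp add: mult.commute)
qed

text \<open>
  A solution for the exponents a, b, c, in which y is a rational polynomial g in x, so that a
  conjugate of x determines a conjugate of the solution. The polynomial F0 witnesses that x is
  algebraic. For the finiteness claim, b and c are two large exponents that share the solution.
\<close>

locale two_large_exponents =
  fixes a b c :: nat and x y :: complex and F0 g :: "rat poly"
  assumes alg: "F0 \<noteq> 0" "qeval F0 x = 0" and y: "y = qeval g x"
    and sol: "1 + x ^ a + y ^ a = 0" "1 + x ^ b + y ^ b = 0" "1 + x ^ c + y ^ c = 0"
    and nz: "x \<noteq> 0" "y \<noteq> 0" and circle: "\<not> (norm x = 1 \<and> norm y = 1)"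
    and order: "0 < a" "600 * a \<le> b" "b < c"
begin

lemma conjugate_sol:
  assumes "conjugate x s"
  shows "1 + s ^ b + qeval g s ^ b = 0" "1 + s ^ c + qeval g s ^ c = 0"
proof -
  have "qeval (1 + [:0, 1:] ^ n + g ^ n) s = 0" if "1 + x ^ n + y ^ n = 0" for n
  proof -
    have "qeval (1 + [:0, 1:] ^ n + g ^ n) x = 0" using that unfolding y by simp
    then show ?thesis using assms unfolding conjugate_def by blast
  qed
  from this[OF sol(2)] this[OF sol(3)]
  show "1 + s ^ b + qeval g s ^ b = 0" "1 + s ^ c + qeval g s ^ c = 0" by simp_all
qed

text \<open>
  If the first two elementary symmetric functions of 1, x^a, y^a vanish, these numbers are the
  cube roots of unity, up to order, and then x and y have absolute value 1.
\<close>

lemma e2_nonzero: "x ^ a + x ^ a * y ^ a + y ^ a \<noteq> 0"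
proof
  assume e2: "x ^ a + x ^ a * y ^ a + y ^ a = 0"
  have norm1: "norm z = 1" if "1 + u + v = 0" "u + u * v + v = 0" "u = z ^ a" for u v z :: complex
  proof -
    have v: "v = - 1 - u" using that(1) by (simp add: algebra_simps add_eq_0_iff)
    have "u ^ 2 + u + 1 = 0" using that(2) unfolding v by (simp add: algebra_simps power2_eq_square add_eq_0_iff)
    then have "(u - 1) * (u ^ 2 + u + 1) = 0" by simp
    then have "u ^ 3 = 1" by (simp add: algebra_simps power2_eq_square power3_eq_cube)
    then have "z ^ (a * 3) = 1" unfolding that(3) by (simp only: power_mult)
    from power_eq_1_iff[OF this] show ?thesis using order(1) by simp
  qed
  have "norm x = 1" using norm1[OF sol(1) e2 refl] .
  moreover have "norm y = 1" using norm1[of "y ^ a" "x ^ a"] sol(1) e2 by (simp add: algebra_simps)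
  ultimately show False using circle by blast
qed

text \<open>
  For c close to b the vectors of b-th and of c-th powers themselves suffice: their cross product,
  divided by the b-th power of x y, has degree c - 2 b. It vanishes only if x and y are roots of
  unity.
\<close>

lemma c_lower: "7 * b < 4 * c"
proof (rule ccontr)
  assume "\<not> 7 * b < 4 * c"
  then have c: "4 * c \<le> 7 * b" by simp
  define e where "e = 2 * b - c"
  have e: "0 + (c - b) + e = b" "4 * e \<ge> b" unfolding e_def using c order by linarith+
  have one: "int_form 0 1 (\<lambda>u v w. 1)" using int_form.const[of 1] by simp
  note pows = int_form_power[OF int_form.fst, of "c - b", simplified]
    int_form_power[OF int_form.snd, of "c - b", simplified] int_form_power[OF int_form.thd, of "c - b", simplified]
  have split: "z ^ b * z ^ (c - b) = z ^ c" for z :: complex using order by (simp flip: power_add)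
  have "8 * a < 2 * e" using e order by linarith
  then have "(2 * 1) ^ (8 * a) < (2::real) ^ (2 * e)" by simp
  then have C: "(2 * 1) ^ (8 * a) < (4::real) ^ e" by (simp add: power_mult)
  have "1 * 1 ^ (c - b) = 1 * y ^ (c - b) \<and> 1 * y ^ (c - b) = 1 * x ^ (c - b)"
    by (rule cross_product_forms[OF alg y sol(1) nz e2_nonzero one one one pows e(1) _ _ C])
       (use conjugate_sol split in simp_all)
  then have "y ^ (c - b) = 1" "x ^ (c - b) = 1" by (simp, metis mult_1 power_one)
  from power_eq_1_iff[OF this(1)] power_eq_1_iff[OF this(2)] show False using circle order by simp
qed

text \<open>
  The cross products of the vector of c-th powers with the Pade systems for (p+1, p, r) and (p,
  p+1, r) both have total degree (2p + r + 2) b + c, and 3 k is the degree of the factor that is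
  removed. If both vanished, the two systems would be proportional, contrary to their
  nondegeneracy. The coefficient bound is 2 * 4^S with S = 2p + r + 2, so the condition on e says
  that (2 * 4^S)^(8a) < 4^e.
\<close>

lemma pade_step:
  assumes k: "k \<le> (p + r + 1) * b" "k \<le> (2 * p + 2) * b" "k \<le> c"
    and e: "(2 * p + r + 2) * b + c + e = 3 * k"
    and big: "4 * a * (4 * p + 2 * r + 5) < e"
  shows False
proof -
  define S where "S = 2 * p + r + 2"
  note pows = int_form_power[OF int_form.fst, of "c - k", simplified]
    int_form_power[OF int_form.snd, of "c - k", simplified] int_form_power[OF int_form.thd, of "c - k", simplified]
  have "(2 * 4 ^ S) ^ (8 * a) = (2::real) ^ ((2 * S + 1) * (8 * a))"
    by (simp only: power_mult) (simp add: power_mult)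
  also have "\<dots> < 2 ^ (2 * e)"
    using big unfolding S_def by (intro power_strict_increasing) (auto simp: algebra_simps)
  finally have C: "(2 * 4 ^ S) ^ (8 * a) < (4::real) ^ e" by (simp add: power_mult)
  have split: "z ^ k * z ^ (c - k) = z ^ c" for z :: complex using k by (simp flip: power_add)
  have *: "pade_term p1 p2 r (x ^ b) 1 * y ^ c = pade_term r p1 p2 1 (y ^ b)"
    if p: "p1 + p2 = 2 * p + 1" "p \<le> p1" "p \<le> p2" for p1 p2
  proof -
    have "(p + r + 1) * b \<le> (r + p1 + 1) * b" "(p + r + 1) * b \<le> (p2 + r + 1) * b"
      "(2 * p + 2) * b \<le> (p1 + p2 + 1) * b"
      using p by (auto intro!: mult_le_mono1)
    then have kk: "k \<le> (p1 + p2 + 1) * b" "k \<le> (p2 + r + 1) * b" "k \<le> (r + p1 + 1) * b"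
      using k by linarith+
    have S: "p1 + p2 + r + 1 = S" "p2 + r + p1 + 1 = S" "r + p1 + p2 + 1 = S" using p unfolding S_def by auto
    have kS: "k \<le> S * b"
      using k(2) mult_le_mono1[of "2 * p + 2" S b] unfolding S_def by linarith
    have deg: "S * b - k + (c - k) + e = k" using e kS k(3) unfolding S_def by linarith
    note A = int_form_cofactor[OF int_form.snd int_form.fst kk(1), of r, unfolded S]
      int_form_cofactor[OF int_form.thd int_form.snd kk(2), of p1, unfolded S]
      int_form_cofactor[OF int_form.fst int_form.thd kk(3), of p2, unfolded S]
    have "cofactor b k r p1 p2 1 y * 1 ^ (c - k) = cofactor b k p1 p2 r x 1 * y ^ (c - k) \<and>
        cofactor b k p2 r p1 y x * y ^ (c - k) = cofactor b k r p1 p2 1 y * x ^ (c - k)"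
    proof (rule cross_product_forms[OF alg y sol(1) nz e2_nonzero A pows deg _ _ C])
      fix s assume s: "conjugate x s"
      show "cofactor b k p1 p2 r s 1 + s ^ k * cofactor b k p2 r p1 (qeval g s) s +
          qeval g s ^ k * cofactor b k r p1 p2 1 (qeval g s) = 0"
        using cofactor_mult[OF kk(1), of 1 r s] cofactor_mult[OF kk(2), of s p1 "qeval g s"]
          cofactor_mult[OF kk(3), of "qeval g s" p2 1]
          pade_identity[of "s ^ b" "qeval g s ^ b" 1 p1 p2 r] conjugate_sol(1)[OF s]
        by (simp add: add_ac)
      show "1 ^ (c - k) + s ^ k * s ^ (c - k) + qeval g s ^ k * qeval g s ^ (c - k) = 0"
        using conjugate_sol(2)[OF s] by (simp add: split)
    qed
    then have "y ^ k * cofactor b k r p1 p2 1 y = cofactor b k p1 p2 r x 1 * (y ^ k * y ^ (c - k))"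
      by simp
    then show ?thesis
      using cofactor_mult[OF kk(1), of 1 r x] cofactor_mult[OF kk(3), of y p2 1] by (simp add: split)
  qed
  have x: "x ^ b = - 1 - y ^ b" using sol(2) by (simp add: algebra_simps add_eq_0_iff)
  have "y ^ b \<noteq> -1" using x nz by auto
  moreover have "y ^ b \<noteq> 0" using nz by simp
  ultimately have "pade_term (p + 1) p r (x ^ b) 1 * pade_term r p (p + 1) 1 (y ^ b)
      \<noteq> pade_term r (p + 1) p 1 (y ^ b) * pade_term p (p + 1) r (x ^ b) 1"
    unfolding x by (intro pade_nondegenerate)
  moreover have "pade_term (p + 1) p r (x ^ b) 1 * y ^ c = pade_term r (p + 1) p 1 (y ^ b)"
    "pade_term p (p + 1) r (x ^ b) 1 * y ^ c = pade_term r p (p + 1) 1 (y ^ b)"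
    by (rule *; simp)+
  ultimately show False by (metis mult.assoc mult.commute)
qed

text \<open>
  The balanced choice p = N - 1, r = N removes the 2N-th powers of the coordinates and leaves
  degree max (c - 3 N b, 3 N b - 2 c), which is negative when c / b lies strictly between 3 N / 2
  and 3 N. The bounds 1.6 N and 2.9 N leave a gain of at least N b / 10 \<ge> 60 a N, whereas at
  most 28 a N is required.
\<close>

lemma pade_step_diagonal:
  assumes "0 < N" "16 * (N * b) \<le> 10 * c" "10 * c \<le> 29 * (N * b)"
  shows False
proof -
  define P where "P = N * b"
  have P: "600 * (a * N) \<le> P" using order(2) unfolding P_def by (metis mult.assoc mult.commute mult_le_mono1)
  have N: "1 \<le> a * N" using assms order by simp
  obtain p where p: "N = p + 1" using assms(1) by (metis Suc_eq_plus1 Suc_pred)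
  define k where "k = min (2 * P) c"
  define e where "e = 3 * k - (3 * P + c)"
  have a: "16 * P \<le> 10 * c" "10 * c \<le> 29 * P" using assms P_def by auto
  have e: "3 * P + c + e = 3 * k" "P \<le> 10 * e" unfolding e_def k_def min_def using a by (auto split: if_splits)
  have aN: "4 * a * (4 * p + 2 * N + 5) = 24 * (a * N) + 4 * a" unfolding p by (simp add: algebra_simps)
  have "a \<le> a * N" using assms(1) by simp
  then have big: "4 * a * (4 * p + 2 * N + 5) < e" unfolding aN using P e(2) N by linarith
  show False
  proof (rule pade_step[OF _ _ _ _ big])
    have "(p + N + 1) * b = 2 * P" "(2 * p + 2) * b = 2 * P" "(2 * p + N + 2) * b = 3 * P"
      unfolding P_def p by (simp_all add: algebra_simps)
    then show "k \<le> (p + N + 1) * b" "k \<le> (2 * p + 2) * b" "k \<le> c" "(2 * p + N + 2) * b + c + e = 3 * k"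
      using e unfolding k_def by simp_all
  qed
qed

text \<open>
  The intervals from 1.6 N to 2.9 N cover all ratios c / b above 7/4 except a neighbourhood of 3,
  the common boundary point of the cases N = 1 and N = 2. There the choice p = r = 1 is used,
  which removes cubes. Ratios up to 7/4 are excluded by lemma c_lower.
\<close>

lemma no_solution: False
proof -
  note lower = c_lower
  consider "4 * c \<le> 11 * b" | "11 * b < 4 * c" "2 * c \<le> 7 * b" | "7 * b < 2 * c" by linarith
  then show False
  proof cases
    case 1
    then show False using pade_step_diagonal[of 1] lower by simp
  next
    case 2
    define k where "k = min (3 * b) c"
    define e where "e = 3 * k - (5 * b + c)"
    have e: "5 * b + c + e = 3 * k" "b \<le> 2 * e" unfolding e_def k_def min_def using 2 by (auto split: if_splits)
    show False
      by (rule pade_step[of k 1 1 e]) (use e order in \<open>simp_all add: k_def\<close>)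
  next
    case 3
    define N where "N = (c + b) div (2 * b)"
    have b: "0 < b" using order by linarith
    have N: "2 * b * N \<le> c + b" "c + b < 2 * b * (N + 1)"
      using times_div_less_eq_dividend[of "2 * b" "c + b"] dividend_less_times_div[of "2 * b" "c + b"] b
      unfolding N_def by (simp_all add: algebra_simps)
    define P where "P = N * b"
    have P: "2 * P \<le> c + b" "c + b < 2 * P + 2 * b" using N unfolding P_def by (simp_all add: algebra_simps)
    have "2 \<le> N"
    proof (rule ccontr)
      assume "\<not> 2 \<le> N"
      then have "P \<le> 1 * b" unfolding P_def by (intro mult_le_mono1) simp
      then show False using P(2) 3 by linarith
    qed
    then consider "N = 2" | "3 \<le> N" by linarith
    then have "16 * P \<le> 10 * c \<and> 10 * c \<le> 29 * P"
    proof cases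
      case 1
      then show ?thesis using P 3 unfolding P_def by simp
    next
      case 2
      then have "3 * b \<le> P" unfolding P_def by (rule mult_le_mono1)
      then show ?thesis using P by linarith
    qed
    then show False using pade_step_diagonal[of N] \<open>2 \<le> N\<close> unfolding P_def by simp
  qed
qed

end

section \<open>Solutions of the system\<close>

lemma power_gcd_bezout:
  assumes "m \<noteq> 0"
  obtains u v where "\<And>z :: complex. (z ^ m) ^ u = (z ^ n) ^ v * z ^ gcd m n"
proof -
  obtain u v where "m * u = n * v + gcd m n" using bezout_nat[OF assms] by blast
  then have "(z ^ m) ^ u = (z ^ n) ^ v * z ^ gcd m n" for z :: complex
    by (simp only: power_mult[symmetric] power_add[symmetric])
  then show ?thesis by (rule that)
qed

text \<open>
  The exponents n with z^n = 1 are closed under greatest common divisors.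
\<close>

lemma power_1_of_gcd_1:
  fixes z :: complex
  assumes "gcd a (gcd b c) = 1" "z ^ a = 1" "z ^ b = 1" "z ^ c = 1"
  shows "z = 1"
proof -
  have g: "z ^ gcd m n = 1" if "z ^ m = 1" "z ^ n = 1" for m n
  proof (cases "m = 0")
    case False
    then obtain u v where "(z ^ m) ^ u = (z ^ n) ^ v * z ^ gcd m n" using power_gcd_bezout[of m n] by blast
    then show ?thesis using that by simp
  qed (use that in simp)
  have "z ^ gcd a (gcd b c) = 1" by (rule g[OF assms(2) g[OF assms(3,4)]])
  then show ?thesis unfolding assms(1) by simp
qed

text \<open>
  Computing y^(a b) from 1 + x^a + y^a = 0 and from 1 + x^b + y^b = 0 eliminates y.
\<close>

definition elimination_poly :: "nat \<Rightarrow> nat \<Rightarrow> rat poly" where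
  "elimination_poly a b = (- 1 - [:0, 1:] ^ a) ^ b - (- 1 - [:0, 1:] ^ b) ^ a"

text \<open>
  The value at 1 is (-2)^b - (-2)^a.
\<close>

lemma elimination_poly_nonzero:
  assumes "a < b"
  shows "elimination_poly a b \<noteq> 0"
proof
  assume "elimination_poly a b = 0"
  then have "poly (elimination_poly a b) 1 = 0" by simp
  then have "(- 2 :: rat) ^ b = (- 2) ^ a" by (simp add: elimination_poly_def)
  then have "\<bar>- 2 :: rat\<bar> ^ b = \<bar>- 2\<bar> ^ a" by (simp only: power_abs[symmetric])
  then show False using assms by simp
qed

lemma elimination_poly_root:
  assumes "1 + x ^ a + y ^ a = 0" "1 + x ^ b + y ^ b = (0::complex)"
  shows "qeval (elimination_poly a b) x = 0"
proof -
  have y: "y ^ n = - 1 - x ^ n" if "1 + x ^ n + y ^ n = 0" for n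
    using that by (simp add: algebra_simps add_eq_0_iff)
  have "(- 1 - x ^ a) ^ b = (- 1 - x ^ b) ^ a"
    unfolding y[OF assms(1), symmetric] y[OF assms(2), symmetric] by (simp add: mult.commute flip: power_mult)
  then show ?thesis by (simp add: elimination_poly_def)
qed

lemma finite_solutions:
  assumes "0 < a" "a < b"
  shows "finite {(x, y). 1 + x ^ a + y ^ a = (0::complex) \<and> 1 + x ^ b + y ^ b = 0}"
proof -
  define A where "A = {x. qeval (elimination_poly a b) x = 0}"
  have "finite A" unfolding A_def qeval_def using elimination_poly_nonzero[OF assms(2)]
    by (intro poly_roots_finite) (simp add: map_poly_eq_0_iff)
  moreover have "finite {y. y ^ a = - 1 - x ^ a}" for x :: complex
    using assms(1) by (rule finite_nth_roots)
  ultimately have "finite (SIGMA x:A. {y. y ^ a = - 1 - x ^ a})" by (rule finite_SigmaI)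
  moreover have "{(x, y). 1 + x ^ a + y ^ a = 0 \<and> 1 + x ^ b + y ^ b = 0} \<subseteq> (SIGMA x:A. {y. y ^ a = - 1 - x ^ a})"
    using elimination_poly_root unfolding A_def by (auto simp: algebra_simps add_eq_0_iff)
  ultimately show ?thesis by (rule finite_subset[rotated])
qed

text \<open>
  By the equations, the powers y^a, y^b, y^c lie in the field Q(x) = Q[x], and y is a product of
  integral powers of them.
\<close>

lemma in_rational_subfield:
  assumes alg: "F0 \<noteq> 0" "qeval F0 x = 0" and gcd: "gcd a (gcd b c) = 1" and y: "y \<noteq> 0"
    and "1 + x ^ a + y ^ a = 0" "1 + x ^ b + y ^ b = 0" "1 + x ^ c + y ^ c = 0"
  shows "\<exists>g. y = qeval g x"
proof -
  define K where "K = range (\<lambda>g. qeval g x)"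
  have mult: "s * t \<in> K" if "s \<in> K" "t \<in> K" for s t
    using that unfolding K_def by (auto simp flip: qeval_mult)
  have pow: "s ^ n \<in> K" if "s \<in> K" for s n
    using that unfolding K_def by (auto simp flip: qeval_power)
  have inv: "inverse s \<in> K" if "s \<in> K" for s
  proof (cases "s = 0")
    case False
    from that obtain F where F: "s = qeval F x" unfolding K_def by blast
    then obtain G where "qeval F x * qeval G x = 1" using qeval_inverse[OF alg, of F] False by blast
    then have "inverse s = qeval G x" unfolding F by (rule inverse_unique)
    then show ?thesis unfolding K_def by blast
  qed (use that in simp)
  have g: "y ^ gcd m n \<in> K" if "y ^ m \<in> K" "y ^ n \<in> K" for m n
  proof (cases "m = 0")
    case False
    then obtain u v where "(y ^ m) ^ u = (y ^ n) ^ v * y ^ gcd m n" using power_gcd_bezout[of m n] by blast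
    then have "y ^ gcd m n = (y ^ m) ^ u * inverse ((y ^ n) ^ v)" using y by (simp add: field_simps)
    then show ?thesis using that mult pow inv by simp
  qed (use that in simp)
  have e: "y ^ n \<in> K" if "1 + x ^ n + y ^ n = 0" for n
  proof -
    have "y ^ n = qeval (- 1 - [:0, 1:] ^ n) x" using that by (simp add: algebra_simps add_eq_0_iff)
    then show ?thesis unfolding K_def by blast
  qed
  have "y ^ gcd a (gcd b c) \<in> K" by (rule g[OF e[OF assms(5)] g[OF e[OF assms(6)] e[OF assms(7)]]])
  then show ?thesis unfolding gcd K_def by auto
qed

text \<open>
  If x = 0, then y^a = y^b = y^c = -1, so y = -1 and all three exponents are odd.
\<close>

lemma nonzero_coordinate:
  assumes "2 dvd a * b * c" "gcd a (gcd b c) = 1" and abc: "0 < a" "0 < b" "0 < c"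
    and "1 + x ^ a + y ^ a = (0::complex)" "1 + x ^ b + y ^ b = 0" "1 + x ^ c + y ^ c = 0"
  shows "x \<noteq> 0"
proof
  assume "x = 0"
  then have y: "y ^ a = - 1" "y ^ b = - 1" "y ^ c = - 1"
    using assms(3-8) by (simp_all add: power_0_left eq_neg_iff_add_eq_0 add.commute)
  have sq: "(y ^ 2) ^ n = 1" if "y ^ n = - 1" for n
  proof -
    have "(y ^ 2) ^ n = (y ^ n) ^ 2" by (simp only: power_mult[symmetric] mult.commute)
    then show ?thesis using that by simp
  qed
  have "y ^ 2 = 1" by (rule power_1_of_gcd_1[OF assms(2) sq[OF y(1)] sq[OF y(2)] sq[OF y(3)]])
  then have "y = 1 \<or> y = - 1" by (simp add: power2_eq_1_iff)
  then have "odd a" "odd b" "odd c" using y by (auto simp: minus_one_power_iff split: if_splits)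
  then show False using assms(1) by simp
qed

text \<open>
  Two numbers of absolute value 1 with sum -1 are the two primitive cube roots of unity. So the
  a-th, b-th and c-th powers of x^3 are 1.
\<close>

lemma not_both_unit:
  assumes gcd: "gcd a (gcd b c) = 1" and ncr: "\<not> is_cube_root_of_unity x"
    and "1 + x ^ a + y ^ a = (0::complex)" "1 + x ^ b + y ^ b = 0" "1 + x ^ c + y ^ c = 0"
  shows "\<not> (norm x = 1 \<and> norm y = 1)"
proof
  assume n: "norm x = 1 \<and> norm y = 1"
  have cube: "(x ^ 3) ^ m = 1" if e: "1 + x ^ m + y ^ m = 0" for m
  proof -
    define u where "u = x ^ m"
    have u: "norm u = 1" "norm (1 + u) = 1"
    proof -
      show "norm u = 1" using n by (simp add: u_def norm_power)
      have "1 + u = - (y ^ m)" using e unfolding u_def by (simp add: eq_neg_iff_add_eq_0)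
      then show "norm (1 + u) = 1" using n by (simp add: norm_power)
    qed
    have 1: "u * cnj u = 1" "(1 + u) * cnj (1 + u) = 1"
      using u complex_norm_square[of u] complex_norm_square[of "1 + u"] by simp_all
    then have "1 + u + cnj u = 0" by (simp add: algebra_simps)
    then have "u * (1 + u + cnj u) = 0" by simp
    then have "u ^ 2 + u + 1 = 0" using 1(1) by (simp add: algebra_simps power2_eq_square)
    then have "(u - 1) * (u ^ 2 + u + 1) = 0" by simp
    then have "u ^ 3 = 1" by (simp add: algebra_simps power2_eq_square power3_eq_cube)
    then show ?thesis unfolding u_def by (simp only: power_mult[symmetric] mult.commute)
  qed
  have "x ^ 3 = 1" by (rule power_1_of_gcd_1[OF gcd cube[OF assms(3)] cube[OF assms(4)] cube[OF assms(5)]])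
  then show False using ncr unfolding is_cube_root_of_unity_def by simp
qed

text \<open>
  The exponents a, b, c serve to establish that x and y are nonzero, not both of absolute value 1,
  and that y lies in Q(x). The bound itself then applies to any two exponents m < n that the
  solution also satisfies; for the finiteness claim these are two of infinitely many values of c.
\<close>

lemma exponent_bound:
  assumes "2 dvd a * b * c" "gcd a (gcd b c) = 1" "0 < a" "a < b" "0 < c" "\<not> is_cube_root_of_unity x"
    and sol: "1 + x ^ a + y ^ a = (0::complex)" "1 + x ^ b + y ^ b = 0" "1 + x ^ c + y ^ c = 0"
    and mn: "1 + x ^ m + y ^ m = 0" "1 + x ^ n + y ^ n = 0" "m < n"
  shows "m < 600 * a"
proof (rule ccontr)
  assume "\<not> m < 600 * a"
  have "0 < b" using assms by simp
  have x: "x \<noteq> 0" by (rule nonzero_coordinate[OF assms(1-3) \<open>0 < b\<close> assms(5) sol])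
  have y: "y \<noteq> 0"
    by (rule nonzero_coordinate[OF assms(1-3) \<open>0 < b\<close> assms(5), of y x]) (use sol in \<open>simp_all add: add_ac\<close>)
  note alg = elimination_poly_nonzero[OF assms(4)] elimination_poly_root[OF sol(1,2)]
  obtain g where g: "y = qeval g x" using in_rational_subfield[OF alg assms(2) y sol] by blast
  have "two_large_exponents a m n x y (elimination_poly a b) g"
    by unfold_locales (use alg g sol mn x y not_both_unit[OF assms(2,6) sol] assms(3) \<open>\<not> m < 600 * a\<close> in auto)
  then show False by (rule two_large_exponents.no_solution)
qed

theorem theorem5p1:
  shows "(\<forall>a b c :: nat. 2 \<le> a \<and> a < b \<and> b < c \<and> 2 dvd a * b * c \<and> gcd a (gcd b c) = 1 \<and>
            has_nontrivial_solution a b c \<longrightarrow>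
              b < 600 * a ^ 2 * 2 ^ a \<and>
              ((\<exists>!n. n \<in> {a, b, c} \<and> even n) \<longrightarrow> b < 600 * a ^ 2)) \<and>
         (\<forall>a b :: nat. 2 \<le> a \<and> a < b \<and> b < 600 * a ^ 2 * 2 ^ a \<longrightarrow>
            finite {c :: nat. b < c \<and> 2 dvd a * b * c \<and> gcd a (gcd b c) = 1 \<and>
              has_nontrivial_solution a b c})"
proof (intro conjI allI impI; (elim conjE)?)
  fix a b c :: nat
  assume *: "2 \<le> a" "a < b" "b < c" "2 dvd a * b * c" "gcd a (gcd b c) = 1" "has_nontrivial_solution a b c"
  then obtain x y where xy: "\<not> is_cube_root_of_unity x" "1 + x ^ a + y ^ a = 0" "1 + x ^ b + y ^ b = 0" "1 + x ^ c + y ^ c = 0"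
    unfolding has_nontrivial_solution_def by blast
  have "b < 600 * a"
    by (rule exponent_bound[OF *(4,5) _ *(2) _ xy xy(3,4) *(3)]) (use * in auto)
  also have "600 * a \<le> 600 * a ^ 2" by (simp add: power2_eq_square)
  finally show b: "b < 600 * a ^ 2" .
  also have "600 * a ^ 2 * 1 \<le> 600 * a ^ 2 * 2 ^ a" by (rule mult_le_mono2) simp
  finally show "b < 600 * a ^ 2 * 2 ^ a" by simp
next
  fix a b :: nat
  assume *: "2 \<le> a" "a < b"
  define A where "A = {c. b < c \<and> 2 dvd a * b * c \<and> gcd a (gcd b c) = 1 \<and> has_nontrivial_solution a b c}"
  define Sol where "Sol = {(x, y). 1 + x ^ a + y ^ a = (0::complex) \<and> 1 + x ^ b + y ^ b = 0}"
  have "finite Sol" unfolding Sol_def using * by (intro finite_solutions) auto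
  have "\<forall>c\<in>A. \<exists>p. p \<in> Sol \<and> \<not> is_cube_root_of_unity (fst p) \<and> 1 + fst p ^ c + snd p ^ c = 0"
    unfolding A_def has_nontrivial_solution_def Sol_def by fastforce
  then obtain f where f: "\<And>c. c \<in> A \<Longrightarrow> f c \<in> Sol" "\<And>c. c \<in> A \<Longrightarrow> \<not> is_cube_root_of_unity (fst (f c))"
      "\<And>c. c \<in> A \<Longrightarrow> 1 + fst (f c) ^ c + snd (f c) ^ c = 0" by metis
  have "finite A"
  proof (rule ccontr)
    assume inf: "infinite A"
    have "finite (f ` A)" using f(1) \<open>finite Sol\<close> by (meson finite_subset image_subsetI)
    then obtain c0 where c0: "c0 \<in> A" "infinite {c \<in> A. f c = f c0}"
      using pigeonhole_infinite[OF inf] by blast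
    obtain m where m: "m \<in> A" "f m = f c0" "600 * a \<le> m"
      using c0(2) unfolding infinite_nat_iff_unbounded_le by blast
    obtain n where n: "n \<in> A" "f n = f c0" "m < n"
      using c0(2) unfolding infinite_nat_iff_unbounded by blast
    obtain x y where xy: "f c0 = (x, y)" by (rule prod.exhaust)
    have c0': "b < c0" "2 dvd a * b * c0" "gcd a (gcd b c0) = 1" using c0(1) unfolding A_def by blast+
    have e: "1 + x ^ a + y ^ a = 0" "1 + x ^ b + y ^ b = 0" using f(1)[OF c0(1)] unfolding xy Sol_def by auto
    have e': "\<not> is_cube_root_of_unity x" "1 + x ^ c0 + y ^ c0 = 0" "1 + x ^ m + y ^ m = 0" "1 + x ^ n + y ^ n = 0"
      using f(2,3)[OF c0(1)] f(3)[OF m(1)] f(3)[OF n(1)] unfolding m(2) n(2) xy by simp_all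
    have "m < 600 * a"
      by (rule exponent_bound[OF c0'(2,3) _ *(2) _ e'(1) e e'(2,3,4) n(3)]) (use * c0' in linarith)+
    then show False using m(3) by simp
  qed
  then show "finite {c. b < c \<and> 2 dvd a * b * c \<and> gcd a (gcd b c) = 1 \<and> has_nontrivial_solution a b c}"
    unfolding A_def .
qed

end
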